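(* There is a randomized algorithm which, given $\delta\in(0,1/2)$ and a set $X$ of $n$ points in $\mathbb{R}^d$ (accessible only through noisy coordinate-comparison queries), outputs a subset of $X$ which, with probability at least $1-\delta$, is the skyline of $X$, and whose expected number of queries is $O(nd\log(dk/\delta))$, where $k=|\mathrm{skyline}(X)|$. The algorithm does not need to know $k$.
   Context: Noisy comparison model: the algorithm may ask queries of the form "is the $i$-th coordinate of point $p$ (strictly) smaller than that of point $q$?"; each answer is correct with probability at least $2/3$, independently of all other answers (repeating a query gives fresh independent answers). A point $p$ is dominated by $q$ if $p_i\le q_i$ for every coordinate $i$, and strictly dominated if moreover $p_i<q_i$ for at least one $i$. The skyline of $X$ is the set of points of $X$ that are not strictly dominated by any other point of $X$. Query complexity is the number of queries made. *)

theory Defs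
  imports "HOL-Probability.Probability"
begin

text \<open>
  Adaptive randomized query algorithms are decision trees with query nodes (branching on the
  Boolean answer) and internal random choices. Trees are well-founded, so an algorithm halts on
  every sequence of answers and random choices, but there need not be a bound on the number of
  queries. Only queries are charged for.
\<close>

datatype (queries: 'q, outputs: 'r) query_alg =
    Return 'r
  | Sample "nat pmf" "nat \<Rightarrow> ('q, 'r) query_alg"
  | Query 'q "bool \<Rightarrow> ('q, 'r) query_alg"

text \<open>
  \<open>run A Q t\<close> is the joint distribution of the output and of the total number of queries when
  \<open>A\<close> is started after \<open>t\<close> queries have already been made. \<open>Q t q\<close> is the distribution of the
  answer if the query with number \<open>t\<close> (counting from 0) is \<open>q\<close>; every answer is a fresh sample.
  Letting it depend on \<open>t\<close> allows the answers to a repeated query to have different error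
  probabilities.
\<close>

primrec run :: "('q, 'r) query_alg \<Rightarrow> (nat \<Rightarrow> 'q \<Rightarrow> bool pmf) \<Rightarrow> nat \<Rightarrow> ('r \<times> nat) pmf" where
  "run (Return r) Q t = return_pmf (r, t)"
| "run (Sample D A) Q t = bind_pmf D (\<lambda>s. run (A s) Q t)"
| "run (Query q A) Q t = bind_pmf (Q t q) (\<lambda>b. run (A b) Q (Suc t))"

definition expected_queries :: "('q, 'r) query_alg \<Rightarrow> (nat \<Rightarrow> 'q \<Rightarrow> bool pmf) \<Rightarrow> ennreal" where
  "expected_queries A Q = (\<integral>\<^sup>+ (r, t). of_nat t \<partial>measure_pmf (run A Q 0))"

definition success_prob ::
    "('q, 'r) query_alg \<Rightarrow> (nat \<Rightarrow> 'q \<Rightarrow> bool pmf) \<Rightarrow> ('r \<Rightarrow> bool) \<Rightarrow> real" where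
  "success_prob A Q P = measure_pmf.prob (run A Q 0) {(r, t). P r}"

text \<open>Points of $d$-dimensional real space are extensional functions on \<open>{..<d}\<close>.\<close>

type_synonym point = "nat \<Rightarrow> real"

abbreviation space_of_dim :: "nat \<Rightarrow> point set" where
  "space_of_dim d \<equiv> {..<d} \<rightarrow>\<^sub>E UNIV"

definition dominated :: "nat \<Rightarrow> point \<Rightarrow> point \<Rightarrow> bool" where
  "dominated d p q \<longleftrightarrow> (\<forall>i<d. p i \<le> q i)"

definition strictly_dominated :: "nat \<Rightarrow> point \<Rightarrow> point \<Rightarrow> bool" where
  "strictly_dominated d p q \<longleftrightarrow> dominated d p q \<and> (\<exists>i<d. p i < q i)"

definition skyline :: "nat \<Rightarrow> point set \<Rightarrow> point set" where
  "skyline d X = {p \<in> X. \<not> (\<exists>q \<in> X - {p}. strictly_dominated d p q)}"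

text \<open>
  An algorithm sees the \<open>n\<close> input points only through labels \<open>a < n\<close>. The query \<open>(i, a, b)\<close> asks
  whether coordinate \<open>i\<close> of the point labelled \<open>a\<close> is smaller than that of the point
  labelled \<open>b\<close>.
\<close>

type_synonym cmp_query = "nat \<times> nat \<times> nat"

definition cmp_queries :: "nat \<Rightarrow> nat \<Rightarrow> cmp_query set" where
  "cmp_queries n d = {..<d} \<times> {..<n} \<times> {..<n}"

definition noisy_oracle ::
    "nat \<Rightarrow> nat \<Rightarrow> (nat \<Rightarrow> point) \<Rightarrow> (nat \<Rightarrow> cmp_query \<Rightarrow> bool pmf) \<Rightarrow> bool" where
  "noisy_oracle n d pt Q \<longleftrightarrow>
     (\<forall>t. \<forall>(i, a, b) \<in> cmp_queries n d. pmf (Q t (i, a, b)) (pt a i < pt b i) \<ge> 2 / 3)"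

end

theory Submission
  imports Defs "HOL-Library.Discrete_Functions"
begin

text \<open>
  If a bound \<open>K = 2 ^ l\<close> with \<open>K > k\<close> and \<open>K \<ge> d\<close> were known, one could proceed as follows. Sort a random
  sample of \<open>K ^ 10\<close> pivots in every coordinate and locate all points among the pivots by noisy
  binary search, with error probability polynomially small in \<open>K\<close>, for \<open>O(n d log K)\<close> queries.
  Then find the skyline points one by one in decreasing lexicographic order: each time, the next
  one is the lexicographic maximum of the points not dominated by those already found. Up to the few misplaced
  points and the few points that share a gap between pivots with a skyline point found so far, it
  has the lexicographically largest ranks among the points not yet seen to be dominated, so it is
  enough to hold a noisy tournament, with error probabilities decreasing geometrically towards
  the root, among the best \<open>n / K ^ 3\<close> candidates. This makes the \<open>K\<close> rounds cheap.

  If \<open>k \<ge> K\<close>, the first \<open>K\<close> skyline points are still found with high probability, which shows that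
  \<open>K\<close> was too small. Hence one can start with \<open>K\<close> polynomial in \<open>d / \<delta>\<close> and square \<open>K\<close> after
  each failure: the cost is proportional to \<open>l = log K\<close>, so it grows geometrically over the stages, and the failure
  probabilities \<open>1 / K\<close> sum up to at most \<open>\<delta>\<close>. Once \<open>K ^ 10 > n\<close>, all points are sorted.
\<close>

section \<open>Expectations, costs and failure probabilities of query algorithms\<close>

text \<open>The budget allows about log K, never log n, queries per point and coordinate, so some
  points will be misplaced. The way out is that extracting lexicographic maxima has a deterministic
  ideal outcome: the at most K points that an error-free run picks depend on the input alone. A
  union bound over these points and the coordinates controls their ranks and gaps; for all other
  points Markov's inequality limits how many are misplaced. Origin of the exponents: a match learns
  all comparisons among up to K + 1 points, so K rounds with 2^h candidates cost about d l K^3 2^h,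
  which forces 2^h to be near n / K^3. The gaps below K points in d <= K coordinates must fit into
  these candidates, so a gap may hold only about n / K^5 points; K^10 pivots achieve this up to a
  failure probability of order K^-5. Precision \<open>30 * l\<close> lets a placement fail with
  probability 2 / K^20, small against the up to K^11 insertions of pivots. Ties are handled by
  giving every pivot value a rank of its own, so that equality with a pivot can be recognised from
  strict comparisons.\<close>

primrec bind_alg ::
    "('q, 'r) query_alg \<Rightarrow> ('r \<Rightarrow> ('q, 's) query_alg) \<Rightarrow> ('q, 's) query_alg" where
  "bind_alg (Return r) f = f r"
| "bind_alg (Sample D A) f = Sample D (\<lambda>s. bind_alg (A s) f)"
| "bind_alg (Query q A) f = Query q (\<lambda>b. bind_alg (A b) f)"

text \<open>Recursion on the tree keeps the query counter in view, as the time-dependent oracle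
  requires, and turns sequencing of algorithms into composition of expectation transformers
  (\<open>ewp_bind\<close>).\<close>

primrec ewp :: "('q, 'r) query_alg \<Rightarrow> (nat \<Rightarrow> 'q \<Rightarrow> bool pmf) \<Rightarrow> nat \<Rightarrow>
    ('r \<Rightarrow> nat \<Rightarrow> ennreal) \<Rightarrow> ennreal" where
  "ewp (Return r) Q t f = f r t"
| "ewp (Sample D A) Q t f = (\<integral>\<^sup>+ s. ewp (A s) Q t f \<partial>measure_pmf D)"
| "ewp (Query q A) Q t f = (\<integral>\<^sup>+ b. ewp (A b) Q (Suc t) f \<partial>measure_pmf (Q t q))"

lemma ewp_eq_nn_integral: "ewp A Q t f = (\<integral>\<^sup>+ (r, t'). f r t' \<partial>measure_pmf (run A Q t))"
  by (induction A arbitrary: t) (simp_all add: nn_integral_return_pmf nn_integral_bind_pmf)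

lemma ewp_bind: "ewp (bind_alg A f) Q t g = ewp A Q t (\<lambda>r t'. ewp (f r) Q t' g)"
  by (induction A arbitrary: t) simp_all

lemma ewp_cmult: "ewp A Q t (\<lambda>r t'. c * f r t') = c * ewp A Q t f"
  unfolding ewp_eq_nn_integral
  by (subst nn_integral_cmult[symmetric]) (auto intro!: nn_integral_cong)

lemma ewp_add: "ewp A Q t (\<lambda>r t'. f r t' + g r t') = ewp A Q t f + ewp A Q t g"
  unfolding ewp_eq_nn_integral
  by (subst nn_integral_add[symmetric]) (auto intro!: nn_integral_cong)

lemma ewp_const: "ewp A Q t (\<lambda>r t'. c) = c"
  unfolding ewp_eq_nn_integral by (simp add: case_prod_unfold measure_pmf.emeasure_space_1)

lemma ewp_mono_outputs:
  "(\<And>r t'. r \<in> outputs A \<Longrightarrow> f r t' \<le> g r t') \<Longrightarrow> ewp A Q t f \<le> ewp A Q t g"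
proof (induction A arbitrary: t)
  case (Sample D A)
  have "ewp (A s) Q t f \<le> ewp (A s) Q t g" for s
    by (rule Sample.IH) (use Sample.prems in auto)
  then show ?case by (auto intro!: nn_integral_mono)
next
  case (Query q A)
  have "ewp (A b) Q (Suc t) f \<le> ewp (A b) Q (Suc t) g" for b
    by (rule Query.IH) (use Query.prems in auto)
  then show ?case by (auto intro!: nn_integral_mono)
qed simp

lemma ewp_mono: "(\<And>r t'. f r t' \<le> g r t') \<Longrightarrow> ewp A Q t f \<le> ewp A Q t g"
  by (rule ewp_mono_outputs)

text \<open>A worst-case bound over every branch, those of probability zero included. One judgement
  thus yields the query cost and also the inclusions for \<open>queries\<close> and
  \<open>outputs\<close>, which range over the whole tree.\<close>

primrec bounded_alg :: "('q, 'r) query_alg \<Rightarrow> 'q set \<Rightarrow> 'r set \<Rightarrow> nat \<Rightarrow> bool" where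
  "bounded_alg (Return r) S R c \<longleftrightarrow> r \<in> R"
| "bounded_alg (Sample D A) S R c \<longleftrightarrow> (\<forall>s. bounded_alg (A s) S R c)"
| "bounded_alg (Query q A) S R c \<longleftrightarrow> q \<in> S \<and> 0 < c \<and> (\<forall>b. bounded_alg (A b) S R (c - 1))"

lemma bounded_alg_mono:
  "bounded_alg A S R c \<Longrightarrow> R \<subseteq> R' \<Longrightarrow> c \<le> c' \<Longrightarrow> bounded_alg A S R' c'"
proof (induction A arbitrary: c c')
  case (Sample D A)
  have "bounded_alg (A s) S R' c'" for s
    by (rule Sample.IH[where c = c]) (use Sample.prems in auto)
  then show ?case by simp
next
  case (Query q A)
  have "bounded_alg (A b) S R' (c' - 1)" for b
    by (rule Query.IH[where c = "c - 1"]) (use Query.prems in auto)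
  then show ?case using Query.prems by auto
qed auto

lemma bounded_alg_bind:
  "bounded_alg A S R c \<Longrightarrow> (\<And>r. r \<in> R \<Longrightarrow> bounded_alg (f r) S R' c') \<Longrightarrow>
     bounded_alg (bind_alg A f) S R' (c + c')"
proof (induction A arbitrary: c)
  case (Return r)
  then show ?case using bounded_alg_mono[of "f r" S R' c' R' "c + c'"] by simp
next
  case (Query q A)
  have "bounded_alg (bind_alg (A b) f) S R' (c - 1 + c')" for b
    by (rule Query.IH) (use Query.prems in auto)
  moreover have "c - 1 + c' = c + c' - 1" using Query.prems by simp
  ultimately show ?case using Query.prems by auto
qed auto

lemma bounded_alg_bind':
  "bounded_alg A S R c \<Longrightarrow> (\<And>r. r \<in> R \<Longrightarrow> bounded_alg (f r) S R' c') \<Longrightarrow> c + c' \<le> c'' \<Longrightarrow>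
     bounded_alg (bind_alg A f) S R' c''"
  by (rule bounded_alg_mono[OF bounded_alg_bind]) auto

lemma bounded_alg_queries: "bounded_alg A S R c \<Longrightarrow> queries A \<subseteq> S"
  by (induction A arbitrary: c) auto

lemma bounded_alg_outputs: "bounded_alg A S R c \<Longrightarrow> outputs A \<subseteq> R"
  by (induction A arbitrary: c) auto

lemma ewp_mono_bounded:
  assumes "bounded_alg A S R c"
    and "\<And>r t'. r \<in> R \<Longrightarrow> t' \<le> t + c \<Longrightarrow> f r t' \<le> g r t'"
  shows "ewp A Q t f \<le> ewp A Q t g"
  using assms
proof (induction A arbitrary: t c)
  case (Sample D A)
  have "ewp (A s) Q t f \<le> ewp (A s) Q t g" for s
    by (rule Sample.IH[where c = c]) (use Sample.prems in auto)
  then show ?case by (auto intro!: nn_integral_mono)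
next
  case (Query q A)
  have "ewp (A b) Q (Suc t) f \<le> ewp (A b) Q (Suc t) g" for b
  proof (rule Query.IH)
    show "bounded_alg (A b) S R (c - 1)" using Query.prems by simp
    show "f r t' \<le> g r t'" if "r \<in> R" "t' \<le> Suc t + (c - 1)" for r t'
      using that Query.prems by auto
  qed simp
  then show ?case by (auto intro!: nn_integral_mono)
qed auto

text \<open>Answers may depend on the number of the query, so the bound is required for every start
  time \<open>t\<close>; it can then be used after any prefix. \<open>0 \<le> e\<close> prevents
  \<open>ennreal e\<close> from truncating \<open>e\<close>.\<close>

definition fails_le ::
    "('q, 'r) query_alg \<Rightarrow> (nat \<Rightarrow> 'q \<Rightarrow> bool pmf) \<Rightarrow> ('r \<Rightarrow> bool) \<Rightarrow> real \<Rightarrow> bool" where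
  "fails_le A Q P e \<longleftrightarrow> 0 \<le> e \<and> (\<forall>t. ewp A Q t (\<lambda>r _. if P r then 0 else 1) \<le> ennreal e)"

lemma fails_le_nonneg: "fails_le A Q P e \<Longrightarrow> 0 \<le> e"
  by (simp add: fails_le_def)

lemma fails_le_Return: "P r \<Longrightarrow> 0 \<le> e \<Longrightarrow> fails_le (Return r) Q P e"
  by (simp add: fails_le_def)

lemma fails_le_mono:
  assumes "fails_le A Q P e" "\<And>r. r \<in> outputs A \<Longrightarrow> P r \<Longrightarrow> P' r" "e \<le> e'"
  shows "fails_le A Q P' e'"
  unfolding fails_le_def
proof (intro conjI allI)
  show "0 \<le> e'" using assms by (auto simp: fails_le_def)
  fix t
  have "ewp A Q t (\<lambda>r _. if P' r then 0 else 1) \<le> ewp A Q t (\<lambda>r _. if P r then 0 else 1)"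
    by (rule ewp_mono_outputs) (use assms(2) in auto)
  also have "\<dots> \<le> ennreal e" using assms(1) by (auto simp: fails_le_def)
  also have "\<dots> \<le> ennreal e'" using assms(3) by (simp add: ennreal_leI)
  finally show "ewp A Q t (\<lambda>r _. if P' r then 0 else 1) \<le> ennreal e'" .
qed

lemma fails_le_bind:
  assumes A: "fails_le A Q P e"
    and f: "\<And>r. r \<in> outputs A \<Longrightarrow> P r \<Longrightarrow> fails_le (f r) Q P' e'"
    and "0 \<le> e'" "e + e' \<le> e''"
  shows "fails_le (bind_alg A f) Q P' e''"
  unfolding fails_le_def
proof (intro conjI allI)
  note nonneg = fails_le_nonneg[OF A] \<open>0 \<le> e'\<close>
  show "0 \<le> e''" using nonneg assms(4) by simp
  fix t
  let ?F = "\<lambda>r (_::nat). if P' r then 0 else (1::ennreal)"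
  have "ewp (bind_alg A f) Q t ?F = ewp A Q t (\<lambda>r t'. ewp (f r) Q t' ?F)"
    by (rule ewp_bind)
  also have "\<dots> \<le> ewp A Q t (\<lambda>r t'. (if P r then 0 else 1) + ennreal e')"
  proof (rule ewp_mono_outputs)
    fix r t' assume r: "r \<in> outputs A"
    have "ewp (f r) Q t' ?F \<le> ewp (f r) Q t' (\<lambda>_ _. 1)" by (rule ewp_mono) auto
    then have "ewp (f r) Q t' ?F \<le> 1" by (simp add: ewp_const)
    then show "ewp (f r) Q t' ?F \<le> (if P r then 0 else 1) + ennreal e'"
      using f[OF r] by (auto simp: fails_le_def add_increasing2)
  qed
  also have "\<dots> = ewp A Q t (\<lambda>r _. if P r then 0 else 1) + ennreal e'"
    by (simp add: ewp_add ewp_const)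
  also have "\<dots> \<le> ennreal e + ennreal e'"
    using A by (auto simp: fails_le_def intro: add_right_mono)
  also have "\<dots> \<le> ennreal e''" using nonneg assms(4) by (simp flip: ennreal_plus add: ennreal_leI)
  finally show "ewp (bind_alg A f) Q t ?F \<le> ennreal e''" .
qed

text \<open>\<open>f\<close> serves as a weighted count of errors that reaches 1 whenever
  \<open>P\<close> fails, so its expectation bounds the failure probability.\<close>

lemma fails_le_markov:
  assumes "\<And>t. ewp A Q t (\<lambda>r _. f r) \<le> ennreal e" "0 \<le> e"
    and "\<And>r. r \<in> outputs A \<Longrightarrow> f r < 1 \<Longrightarrow> P r"
  shows "fails_le A Q P e"
  unfolding fails_le_def
proof (intro conjI allI)
  fix t
  have "ewp A Q t (\<lambda>r _. if P r then 0 else 1) \<le> ewp A Q t (\<lambda>r _. f r)"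
    by (rule ewp_mono_outputs) (use assms(3) in force)
  then show "ewp A Q t (\<lambda>r _. if P r then 0 else 1) \<le> ennreal e"
    using assms(1)[of t] by simp
qed fact

lemma fails_le_conj:
  assumes "fails_le A Q P e" "fails_le A Q P' e'"
  shows "fails_le A Q (\<lambda>r. P r \<and> P' r) (e + e')"
  unfolding fails_le_def
proof (intro conjI allI)
  show "0 \<le> e + e'" using assms by (simp add: fails_le_def)
  fix t
  have "ewp A Q t (\<lambda>r _. if P r \<and> P' r then 0 else 1)
      \<le> ewp A Q t (\<lambda>r _. (if P r then 0 else 1) + (if P' r then 0 else 1))"
    by (rule ewp_mono) auto
  also have "\<dots> \<le> ennreal e + ennreal e'"
    unfolding ewp_add using assms by (auto simp: fails_le_def intro: add_mono)
  also have "\<dots> = ennreal (e + e')" using assms by (simp add: fails_le_def)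
  finally show "ewp A Q t (\<lambda>r _. if P r \<and> P' r then 0 else 1) \<le> ennreal (e + e')" .
qed

lemma fails_le_Ball:
  assumes "finite I" "\<And>i. i \<in> I \<Longrightarrow> fails_le A Q (P i) e"
  shows "fails_le A Q (\<lambda>r. \<forall>i\<in>I. P i r) (real (card I) * e)"
  using assms
proof (induction I rule: finite_induct)
  case empty
  then show ?case by (simp add: fails_le_def ewp_const)
next
  case (insert i I)
  have "fails_le A Q (\<lambda>r. P i r \<and> (\<forall>i\<in>I. P i r)) (e + real (card I) * e)"
    using insert by (intro fails_le_conj) auto
  then show ?case using insert by (simp add: algebra_simps)
qed

primrec collect :: "('a \<Rightarrow> ('q, 'r) query_alg) \<Rightarrow> 'a list \<Rightarrow> ('q, 'a \<Rightarrow> 'r) query_alg" where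
  "collect f [] = Return (\<lambda>_. undefined)"
| "collect f (x # xs) =
     bind_alg (collect f xs) (\<lambda>g. bind_alg (f x) (\<lambda>r. Return (g(x := r))))"

lemma bounded_alg_collect:
  assumes "\<And>x. x \<in> set xs \<Longrightarrow> bounded_alg (f x) S (R x) c"
  shows "bounded_alg (collect f xs) S {g. \<forall>x\<in>set xs. g x \<in> R x} (length xs * c)"
  using assms
proof (induction xs)
  case (Cons x xs)
  have "bounded_alg (bind_alg (f x) (\<lambda>r. Return (g(x := r)))) S
      {g. \<forall>x\<in>set (x # xs). g x \<in> R x} (c + 0)" if "\<forall>x\<in>set xs. g x \<in> R x" for g
    by (rule bounded_alg_bind[where R = "R x"]) (use Cons that in auto)
  then show ?case
    by (auto intro!: bounded_alg_bind'[OF Cons.IH] Cons.prems)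
qed simp

text \<open>Linearity of expectation. The weights \<open>c\<close> later allow one run to guarantee
  both that all important entries are right and that few of the others are wrong.\<close>

lemma ewp_collect_le:
  fixes c :: "'a \<Rightarrow> real"
  assumes "\<And>x. x \<in> set xs \<Longrightarrow> fails_le (f x) Q (P x) e"
    and "\<And>x. 0 \<le> c x" and "0 \<le> e"
  shows "ewp (collect f xs) Q t
       (\<lambda>g _. \<Sum>x\<in>set xs. ennreal (c x) * (if P x (g x) then 0 else 1))
     \<le> ennreal (sum_list (map c xs) * e)"
  using assms(1)
proof (induction xs arbitrary: t)
  case (Cons x xs)
  let ?G = "\<lambda>xs g. \<Sum>x\<in>set xs. ennreal (c x) * (if P x (g x) then 0 else 1)"
  \<comment> \<open>If \<open>x\<close> occurs again in \<open>xs\<close>, the result of the head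
    overwrites the earlier one, so the old term of \<open>x\<close> is dropped before the new one is
    added.\<close>
  have upd: "?G (x # xs) (g(x := r)) \<le> ?G xs g + ennreal (c x) * (if P x r then 0 else 1)" for g r
  proof -
    have "?G (x # xs) (g(x := r)) =
        (\<Sum>y\<in>set xs - {x}. ennreal (c y) * (if P y (g y) then 0 else 1))
        + ennreal (c x) * (if P x r then 0 else 1)"
      by (simp add: sum.insert_remove add.commute)
    also have "\<dots> \<le> ?G xs g + ennreal (c x) * (if P x r then 0 else 1)"
      by (intro add_right_mono sum_mono2) auto
    finally show ?thesis .
  qed
  have "ewp (collect f (x # xs)) Q t (\<lambda>g _. ?G (x # xs) g)
      = ewp (collect f xs) Q t (\<lambda>g t'. ewp (f x) Q t' (\<lambda>r _. ?G (x # xs) (g(x := r))))"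
    by (simp add: ewp_bind)
  also have "\<dots> \<le> ewp (collect f xs) Q t (\<lambda>g t'. ?G xs g + ennreal (c x * e))"
  proof (rule ewp_mono)
    fix g t'
    have "ewp (f x) Q t' (\<lambda>r _. ?G (x # xs) (g(x := r)))
        \<le> ewp (f x) Q t' (\<lambda>r _. ?G xs g + ennreal (c x) * (if P x r then 0 else 1))"
      by (rule ewp_mono) (rule upd)
    also have "\<dots> = ?G xs g + ennreal (c x) * ewp (f x) Q t' (\<lambda>r _. if P x r then 0 else 1)"
      by (simp only: ewp_add ewp_const ewp_cmult)
    also have "\<dots> \<le> ?G xs g + ennreal (c x) * ennreal e"
      using Cons.prems[of x] by (intro add_left_mono mult_left_mono) (auto simp: fails_le_def)
    also have "\<dots> = ?G xs g + ennreal (c x * e)"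
      using assms by (simp add: ennreal_mult)
    finally show "ewp (f x) Q t' (\<lambda>r _. ?G (x # xs) (g(x := r))) \<le> ?G xs g + ennreal (c x * e)" .
  qed
  also have "\<dots> = ewp (collect f xs) Q t (\<lambda>g _. ?G xs g) + ennreal (c x * e)"
    by (simp only: ewp_add ewp_const)
  also have "\<dots> \<le> ennreal (sum_list (map c xs) * e) + ennreal (c x * e)"
    using Cons by (intro add_right_mono) auto
  also have "\<dots> = ennreal (sum_list (map c (x # xs)) * e)"
    using assms by (subst ennreal_plus[symmetric]) (auto simp: algebra_simps intro!: mult_nonneg_nonneg sum_list_nonneg)
  finally show ?case .
qed simp

lemma fails_le_collect:
  assumes "\<And>x. x \<in> set xs \<Longrightarrow> fails_le (f x) Q (P x) e" and "0 \<le> e"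
  shows "fails_le (collect f xs) Q (\<lambda>g. \<forall>x\<in>set xs. P x (g x)) (real (length xs) * e)"
proof (rule fails_le_markov)
  show "ewp (collect f xs) Q t (\<lambda>g _. \<Sum>x\<in>set xs. ennreal 1 * (if P x (g x) then 0 else 1))
      \<le> ennreal (real (length xs) * e)" for t
    using ewp_collect_le[of xs f Q P e "\<lambda>_. 1" t] assms by (simp add: sum_list_triv)
  show "0 \<le> real (length xs) * e" using assms by simp
next
  fix g :: "'a \<Rightarrow> 'c"
  assume less: "(\<Sum>x\<in>set xs. ennreal 1 * (if P x (g x) then 0 else 1)) < 1"
  show "\<forall>x\<in>set xs. P x (g x)"
  proof (rule ccontr)
    assume "\<not> ?thesis"
    then obtain x where "x \<in> set xs" "\<not> P x (g x)" by auto
    then have "1 \<le> (\<Sum>x\<in>set xs. ennreal 1 * (if P x (g x) then 0 else 1))"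
      using member_le_sum[of x "set xs" "\<lambda>x. ennreal 1 * (if P x (g x) then 0 else 1)"] by simp
    then show False using less by simp
  qed
qed

section \<open>Noisy search by multiplicative weights\<close>

text \<open>A test whether the hidden position in \<open>{..N}\<close> is at least \<open>g\<close>,
  where \<open>snd (qf g)\<close> is the answer that means yes. For \<open>g = 0\<close> and
  \<open>g > N\<close> the outcome is known and no query is spent.\<close>

definition ask :: "nat \<Rightarrow> (nat \<Rightarrow> 'q \<times> bool) \<Rightarrow> nat \<Rightarrow> (bool \<Rightarrow> ('q, 'r) query_alg) \<Rightarrow> ('q, 'r) query_alg" where
  "ask N qf g k = (if g = 0 then k True else if g > N then k False
     else Query (fst (qf g)) (\<lambda>b. k (b = snd (qf g))))"

definition reweight :: "nat \<Rightarrow> bool \<Rightarrow> (nat \<Rightarrow> real) \<Rightarrow> nat \<Rightarrow> real" where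
  "reweight g a w = (\<lambda>i. if (g \<le> i) = a then w i else 3 / 4 * w i)"

definition median :: "nat \<Rightarrow> (nat \<Rightarrow> real) \<Rightarrow> nat" where
  "median N w = (LEAST j. (\<Sum>i\<le>N. w i) \<le> 2 * (\<Sum>i\<le>j. w i))"

text \<open>The weights act as an unnormalised posterior. Both thresholds \<open>j\<close> and
  \<open>Suc j\<close> are tested because the median may itself carry most of the weight, and a
  single threshold cannot separate it from both sides. In the end only a position with more than
  half of the weight is trusted; 0 is a mere default.\<close>

primrec search :: "nat \<Rightarrow> (nat \<Rightarrow> 'q \<times> bool) \<Rightarrow> nat \<Rightarrow> (nat \<Rightarrow> real) \<Rightarrow> ('q, nat) query_alg" where
  "search N qf 0 w =
     (let heavy = (\<lambda>i. i \<le> N \<and> (\<Sum>i\<le>N. w i) < 2 * w i)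
      in Return (if \<exists>i. heavy i then SOME i. heavy i else 0))"
| "search N qf (Suc R) w =
     (let j = median N w in
        ask N qf j (\<lambda>a. ask N qf (Suc j) (\<lambda>a'.
          search N qf R (reweight (Suc j) a' (reweight j a w)))))"

definition locate :: "nat \<Rightarrow> (nat \<Rightarrow> 'q \<times> bool) \<Rightarrow> nat \<Rightarrow> ('q, nat) query_alg" where
  "locate N qf b = search N qf (25 * b) (\<lambda>_. 1)"

lemma bounded_alg_ask:
  assumes "\<And>a. bounded_alg (k a) S R c" "\<And>g. 1 \<le> g \<Longrightarrow> g \<le> N \<Longrightarrow> fst (qf g) \<in> S"
  shows "bounded_alg (ask N qf g k) S R (Suc c)"
  using assms bounded_alg_mono[OF assms(1) subset_refl, of "Suc c"] by (auto simp: ask_def)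

lemma bounded_alg_search:
  assumes "\<And>g. 1 \<le> g \<Longrightarrow> g \<le> N \<Longrightarrow> fst (qf g) \<in> S"
  shows "bounded_alg (search N qf R w) S {..N} (2 * R)"
proof (induction R arbitrary: w)
  case 0
  let ?heavy = "\<lambda>i. i \<le> N \<and> (\<Sum>i\<le>N. w i) < 2 * w i"
  have "?heavy (SOME i. ?heavy i)" if "\<exists>i. ?heavy i"
    using that by (rule someI_ex)
  then show ?case by (auto simp: Let_def)
next
  case (Suc R)
  have "bounded_alg (search N qf (Suc R) w) S {..N} (Suc (Suc (2 * R)))"
    unfolding search.simps Let_def
    by (intro bounded_alg_ask assms Suc.IH)
  then show ?case by simp
qed

lemma bounded_alg_locate:
  assumes "\<And>g. 1 \<le> g \<Longrightarrow> g \<le> N \<Longrightarrow> fst (qf g) \<in> S"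
  shows "bounded_alg (locate N qf b) S {..N} (50 * b)"
  using bounded_alg_search[where R = "25 * b", OF assms] by (simp add: locate_def)

section \<open>Decrease of the expected odds in one round\<close>

lemma nn_integral_bool_pmf:
  "(\<integral>\<^sup>+ b. F b \<partial>measure_pmf M) = ennreal (pmf M c) * F c + ennreal (1 - pmf M c) * F (\<not> c)"
proof -
  have "pmf M False + pmf M True = 1"
    using sum_pmf_eq_1[of "UNIV" M] by (auto simp: UNIV_bool)
  then have "pmf M (\<not> c) = 1 - pmf M c" by (cases c) auto
  then show ?thesis
    by (cases c) (simp_all add: nn_integral_measure_pmf_support[of UNIV] nn_integral_measure_pmf UNIV_bool
      nn_integral_count_space_finite add.commute)
qed

text \<open>A wrong answer inflates the odds against the target by more than a correct one deflates
  them, but being at most half as likely it does not prevent a decrease on average.\<close>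

lemma biased_average:
  assumes p: "2 / 3 \<le> pmf M c" and le: "0 \<le> u" "u \<le> v"
    and F: "F c \<le> ennreal u" "F (\<not> c) \<le> ennreal v"
  shows "(\<integral>\<^sup>+ b. F b \<partial>measure_pmf M) \<le> ennreal (2 / 3 * u + 1 / 3 * v)"
proof -
  let ?p = "pmf M c"
  have p1: "?p \<le> 1" by (rule pmf_le_1)
  have "(\<integral>\<^sup>+ b. F b \<partial>measure_pmf M) \<le> ennreal ?p * ennreal u + ennreal (1 - ?p) * ennreal v"
    unfolding nn_integral_bool_pmf[of M F c] by (intro add_mono mult_left_mono F) auto
  also have "\<dots> = ennreal (?p * u + (1 - ?p) * v)"
    using p1 le by (simp add: ennreal_mult)
  also have "\<dots> \<le> ennreal (2 / 3 * u + 1 / 3 * v)"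
  proof (rule ennreal_leI)
    have "(?p - 2 / 3) * (v - u) \<ge> 0" using p le by (intro mult_nonneg_nonneg) auto
    then show "?p * u + (1 - ?p) * v \<le> 2 / 3 * u + 1 / 3 * v" by (simp add: field_simps)
  qed
  finally show ?thesis .
qed

text \<open>The odds against position \<open>t\<close>. The multipliers \<open>a\<close> accumulate
  the expected discounts of later tests, so that a sequence of tests can be analysed from the last
  one backwards.\<close>

definition odds :: "nat \<Rightarrow> nat \<Rightarrow> (nat \<Rightarrow> real) \<Rightarrow> (nat \<Rightarrow> real) \<Rightarrow> real" where
  "odds N t a w = (\<Sum>i\<in>{..N} - {t}. a i * w i) / w t"

definition discount :: "nat \<Rightarrow> nat \<Rightarrow> nat \<Rightarrow> real" where
  "discount t g i = (if (g \<le> i) = (g \<le> t) then 1 else 17 / 18)"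

text \<open>Positions on the side of \<open>t\<close> keep their odds under either answer. On the
  other side a right answer multiplies the odds by 3/4 and a wrong one by 4/3, because then
  \<open>t\<close> loses weight instead. The average is at most 2/3 * 3/4 + 1/3 * 4/3 = 17/18, the
  factor in \<open>discount\<close>.\<close>

lemma ewp_ask_le:
  assumes answers: "\<And>t' g. 1 \<le> g \<Longrightarrow> g \<le> N \<Longrightarrow>
      2 / 3 \<le> pmf (Q t' (fst (qf g))) ((g \<le> t) = snd (qf g))"
    and t: "t \<le> N" and w: "\<And>i. 0 < w i" and a: "\<And>i. 0 \<le> a i"
    and k: "\<And>ans t'. ewp (k ans) Q t' f \<le> ennreal (odds N t a (reweight g ans w))"
  shows "ewp (ask N qf g k) Q t' f \<le> ennreal (odds N t (\<lambda>i. a i * discount t g i) w)"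
proof -
  have trivial: "ewp (k (g \<le> t)) Q t' f \<le> ennreal (odds N t (\<lambda>i. a i * discount t g i) w)"
    if "g = 0 \<or> g > N"
  proof -
    have "(\<Sum>i\<in>{..N} - {t}. a i * reweight g (g \<le> t) w i)
        = (\<Sum>i\<in>{..N} - {t}. a i * discount t g i * w i)"
      by (rule sum.cong) (use that t in \<open>auto simp: reweight_def discount_def\<close>)
    moreover have "reweight g (g \<le> t) w t = w t" by (simp add: reweight_def)
    ultimately have "odds N t a (reweight g (g \<le> t) w) = odds N t (\<lambda>i. a i * discount t g i) w"
      by (simp add: odds_def)
    then show ?thesis using k[of "g \<le> t" t'] by simp
  qed
  show ?thesis
  proof (cases "g = 0 \<or> g > N")
    case True
    then show ?thesis using trivial t by (auto simp: ask_def)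
  next
    case False
    let ?same = "{i \<in> {..N} - {t}. (g \<le> i) = (g \<le> t)}"
    let ?opp = "{i \<in> {..N} - {t}. (g \<le> i) \<noteq> (g \<le> t)}"
    define X where "X = (\<Sum>i\<in>?same. a i * w i) / w t"
    define Y where "Y = (\<Sum>i\<in>?opp. a i * w i) / w t"
    have nonneg: "0 \<le> X" "0 \<le> Y"
      unfolding X_def Y_def
      by (auto intro!: divide_nonneg_nonneg sum_nonneg mult_nonneg_nonneg less_imp_le[OF w] a)
    have split: "(\<Sum>i\<in>{..N} - {t}. h i) = (\<Sum>i\<in>?same. h i) + (\<Sum>i\<in>?opp. h i)"
      for h :: "nat \<Rightarrow> real"
      by (subst sum.union_disjoint[symmetric]) (auto intro!: sum.cong)
    have quot: "(3 / 4 * x + y) / (3 / 4 * z) = x / z + 4 / 3 * (y / z)" if "0 < z"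
      for x y z :: real
      using that by (simp add: field_simps)
    have right: "odds N t a (reweight g (g \<le> t) w) = X + 3 / 4 * Y"
    proof -
      have "(\<Sum>i\<in>?same. a i * reweight g (g \<le> t) w i) = (\<Sum>i\<in>?same. a i * w i)"
        by (rule sum.cong) (auto simp: reweight_def)
      moreover have "(\<Sum>i\<in>?opp. a i * reweight g (g \<le> t) w i) = 3 / 4 * (\<Sum>i\<in>?opp. a i * w i)"
        unfolding sum_distrib_left by (rule sum.cong) (auto simp: reweight_def)
      moreover have "reweight g (g \<le> t) w t = w t" by (simp add: reweight_def)
      ultimately show ?thesis
        unfolding odds_def split X_def Y_def by (simp only: add_divide_distrib times_divide_eq_right)
    qed
    have wrong: "odds N t a (reweight g (\<not> g \<le> t) w) = X + 4 / 3 * Y"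
    proof -
      have "(\<Sum>i\<in>?same. a i * reweight g (\<not> g \<le> t) w i) = 3 / 4 * (\<Sum>i\<in>?same. a i * w i)"
        unfolding sum_distrib_left by (rule sum.cong) (auto simp: reweight_def)
      moreover have "(\<Sum>i\<in>?opp. a i * reweight g (\<not> g \<le> t) w i) = (\<Sum>i\<in>?opp. a i * w i)"
        by (rule sum.cong) (auto simp: reweight_def)
      moreover have "reweight g (\<not> g \<le> t) w t = 3 / 4 * w t" by (simp add: reweight_def)
      ultimately show ?thesis
        unfolding odds_def split X_def Y_def by (simp only: quot[OF w])
    qed
    have disc: "odds N t (\<lambda>i. a i * discount t g i) w = X + 17 / 18 * Y"
    proof -
      have "(\<Sum>i\<in>?same. a i * discount t g i * w i) = (\<Sum>i\<in>?same. a i * w i)"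
        by (rule sum.cong) (auto simp: discount_def)
      moreover have "(\<Sum>i\<in>?opp. a i * discount t g i * w i) = 17 / 18 * (\<Sum>i\<in>?opp. a i * w i)"
        unfolding sum_distrib_left by (rule sum.cong) (auto simp: discount_def)
      ultimately show ?thesis
        unfolding odds_def split X_def Y_def by (simp only: add_divide_distrib times_divide_eq_right)
    qed
    let ?c = "(g \<le> t) = snd (qf g)"
    have "ewp (ask N qf g k) Q t' f
        = (\<integral>\<^sup>+ b. ewp (k (b = snd (qf g))) Q (Suc t') f \<partial>measure_pmf (Q t' (fst (qf g))))"
      using False by (simp add: ask_def)
    also have "\<dots> \<le> ennreal (2 / 3 * (X + 3 / 4 * Y) + 1 / 3 * (X + 4 / 3 * Y))"
    proof (rule biased_average[where c = ?c])
      show "2 / 3 \<le> pmf (Q t' (fst (qf g))) ?c" using False by (intro answers) auto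
      have "(?c = snd (qf g)) = (g \<le> t)" by auto
      then show "ewp (k (?c = snd (qf g))) Q (Suc t') f \<le> ennreal (X + 3 / 4 * Y)"
        using k[of "g \<le> t" "Suc t'"] by (simp add: right)
      have "((\<not> ?c) = snd (qf g)) = (\<not> g \<le> t)" by auto
      then show "ewp (k ((\<not> ?c) = snd (qf g))) Q (Suc t') f \<le> ennreal (X + 4 / 3 * Y)"
        using k[of "\<not> g \<le> t" "Suc t'"] by (simp only: wrong)
    qed (use nonneg in auto)
    also have "2 / 3 * (X + 3 / 4 * Y) + 1 / 3 * (X + 4 / 3 * Y) = X + 17 / 18 * Y"
      by (simp add: field_simps)
    finally show ?thesis by (simp add: disc)
  qed
qed

lemma median_bounds:
  assumes w: "\<And>i. 0 < w i"
  shows "(\<Sum>i\<le>N. w i) \<le> 2 * (\<Sum>i\<le>median N w. w i)"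
    and "(\<Sum>i\<le>N. w i) \<le> 2 * (\<Sum>i\<in>{median N w..N}. w i)"
    and "median N w \<le> N"
proof -
  let ?P = "\<lambda>j. (\<Sum>i\<le>N. w i) \<le> 2 * (\<Sum>i\<le>j. w i)"
  have PN: "?P N" using w by (simp add: sum_nonneg less_imp_le)
  then show "?P (median N w)" unfolding median_def by (rule LeastI)
  show le: "median N w \<le> N" unfolding median_def using PN by (rule Least_le)
  have "2 * (\<Sum>i<median N w. w i) \<le> (\<Sum>i\<le>N. w i)"
  proof (cases "median N w")
    case 0
    then show ?thesis using w by (simp add: sum_nonneg less_imp_le)
  next
    case (Suc j)
    then have "\<not> ?P j" unfolding median_def using not_less_Least[of j ?P] by simp
    then show ?thesis by (simp add: Suc lessThan_Suc_atMost)
  qed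
  moreover have "(\<Sum>i\<le>N. w i) = (\<Sum>i<median N w. w i) + (\<Sum>i\<in>{median N w..N}. w i)"
  proof -
    have "{..N} = {..<median N w} \<union> {median N w..N}" using le by auto
    then show ?thesis by (simp add: sum.union_disjoint[symmetric] ivl_disj_int)
  qed
  ultimately show "(\<Sum>i\<le>N. w i) \<le> 2 * (\<Sum>i\<in>{median N w..N}. w i)" by linarith
qed

text \<open>If \<open>t\<close> is the median, the two tests separate it from all other positions.
  Otherwise one of them separates it from the median and everything beyond, which is at least half
  of the weight. A factor 17/18 on half of the odds is 35/36 on the whole.\<close>

lemma discount_median_le:
  assumes w: "\<And>i. 0 < w i" and t: "t \<le> N"
  shows "odds N t (\<lambda>i. discount t (Suc (median N w)) i * discount t (median N w) i) w
    \<le> 35 / 36 * odds N t (\<lambda>_. 1) w"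
proof -
  define j where "j = median N w"
  let ?I = "{..N} - {t}"
  let ?O = "{i \<in> ?I. (j \<le> i) \<noteq> (j \<le> t) \<or> (Suc j \<le> i) \<noteq> (Suc j \<le> t)}"
  note med = median_bounds[of w N, OF w, folded j_def]
  have nonneg: "0 \<le> w i" for i using w[of i] by simp
  have half: "sum w ?I \<le> 2 * sum w ?O"
  proof (cases t j rule: linorder_cases)
    case equal
    have "?O = ?I" using equal by auto
    moreover have "0 \<le> sum w ?I" by (intro sum_nonneg nonneg)
    ultimately show ?thesis by simp
  next
    case less
    have "sum w ?I \<le> sum w {..N}" by (intro sum_mono2) (auto simp: nonneg)
    also have "\<dots> \<le> 2 * sum w {j..N}" by (rule med)
    also have "sum w {j..N} \<le> sum w ?O" by (intro sum_mono2) (use less in \<open>auto simp: nonneg\<close>)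
    finally show ?thesis by simp
  next
    case greater
    have "sum w ?I \<le> sum w {..N}" by (intro sum_mono2) (auto simp: nonneg)
    also have "\<dots> \<le> 2 * sum w {..j}" by (rule med)
    also have "sum w {..j} \<le> sum w ?O"
      by (intro sum_mono2) (use greater t in \<open>auto simp: nonneg\<close>)
    finally show ?thesis by simp
  qed
  have "(\<Sum>i\<in>?I. discount t (Suc j) i * discount t j i * w i)
      \<le> (\<Sum>i\<in>?I. w i - (if i \<in> ?O then 1 / 18 * w i else 0))"
    by (rule sum_mono) (use nonneg in \<open>auto simp: discount_def\<close>)
  also have "\<dots> = sum w ?I - 1 / 18 * sum w ?O"
  proof -
    have "(\<Sum>i\<in>?I. if i \<in> ?O then 1 / 18 * w i else 0) = (\<Sum>i\<in>?O. 1 / 18 * w i)"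
      by (rule sum.mono_neutral_cong_right) auto
    then show ?thesis by (simp only: sum_subtractf sum_distrib_left)
  qed
  also have "\<dots> \<le> 35 / 36 * sum w ?I" using half by simp
  finally have "odds N t (\<lambda>i. discount t (Suc j) i * discount t j i) w \<le> 35 / 36 * sum w ?I / w t"
    unfolding odds_def using w[of t] by (intro divide_right_mono) auto
  then show ?thesis by (simp add: odds_def j_def)
qed

lemma ewp_search_le:
  assumes answers: "\<And>t' g. 1 \<le> g \<Longrightarrow> g \<le> N \<Longrightarrow>
      2 / 3 \<le> pmf (Q t' (fst (qf g))) ((g \<le> t) = snd (qf g))"
    and t: "t \<le> N" and w: "\<And>i. 0 < w i"
  shows "ewp (search N qf R w) Q t' (\<lambda>r _. if r = t then 0 else 1)
    \<le> ennreal ((35 / 36) ^ R * odds N t (\<lambda>_. 1) w)"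
  using w
proof (induction R arbitrary: w t')
  case 0
  let ?heavy = "\<lambda>i. i \<le> N \<and> (\<Sum>i\<le>N. w i) < 2 * w i"
  have tot: "(\<Sum>i\<le>N. w i) = w t + (\<Sum>i\<in>{..N} - {t}. w i)"
    using t by (simp add: sum.remove)
  show ?case
  \<comment> \<open>Odds below 1 mean that \<open>t\<close> outweighs all other positions together
    and is the only heavy one; otherwise the claimed bound is at least 1.\<close>
  proof (cases "odds N t (\<lambda>_. 1) w < 1")
    case True
    then have lt: "(\<Sum>i\<in>{..N} - {t}. w i) < w t"
      using "0.prems"[of t] by (simp add: odds_def field_simps)
    then have heavy: "?heavy t" using t tot by simp
    have "i = t" if "?heavy i" for i
    proof (rule ccontr)
      assume "i \<noteq> t"
      then have "w i \<le> (\<Sum>i\<in>{..N} - {t}. w i)"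
        using that "0.prems" by (intro member_le_sum) (auto intro: less_imp_le)
      then show False using that lt tot by simp
    qed
    with heavy have "(SOME i. ?heavy i) = t" by (rule some_equality)
    then have "(if \<exists>i. ?heavy i then SOME i. ?heavy i else 0) = t" using heavy by metis
    then show ?thesis by (simp add: Let_def)
  next
    case False
    then have "(1::ennreal) \<le> ennreal (odds N t (\<lambda>_. 1) w)" by simp
    then show ?thesis by (auto simp: Let_def intro: order_trans)
  qed
next
  case (Suc R)
  define j where "j = median N w"
  let ?f = "\<lambda>r (_::nat). if r = t then 0 else (1::ennreal)"
  let ?c = "(35 / 36) ^ R :: real"
  have pos: "0 < reweight g a w i" if "\<And>i. 0 < w i" for g a i and w :: "nat \<Rightarrow> real"
    using that by (simp add: reweight_def)
  have disc: "0 \<le> discount t g i" for g i by (simp add: discount_def)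
  have scale: "odds N t (\<lambda>i. ?c * a i) w = ?c * odds N t a w" for a w
    by (simp add: odds_def sum_distrib_left mult.assoc)
  have second: "ewp (ask N qf (Suc j) (\<lambda>a'. search N qf R (reweight (Suc j) a' w'))) Q t'' ?f
      \<le> ennreal (odds N t (\<lambda>i. ?c * 1 * discount t (Suc j) i) w')"
    if w': "\<And>i. 0 < w' i" for w' t''
  proof (rule ewp_ask_le[OF answers t w'])
    show "ewp (search N qf R (reweight (Suc j) ans w')) Q t' ?f
        \<le> ennreal (odds N t (\<lambda>i. ?c * 1) (reweight (Suc j) ans w'))" for ans t'
      unfolding scale by (rule Suc.IH) (rule pos[OF w'])
  qed simp_all
  have "ewp (search N qf (Suc R) w) Q t' ?f
     = ewp (ask N qf j (\<lambda>a. ask N qf (Suc j) (\<lambda>a'.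
         search N qf R (reweight (Suc j) a' (reweight j a w))))) Q t' ?f"
    by (simp add: Let_def j_def)
  also have "\<dots> \<le> ennreal (odds N t (\<lambda>i. ?c * 1 * discount t (Suc j) i * discount t j i) w)"
  proof (rule ewp_ask_le[OF answers t Suc.prems])
    show "0 \<le> ?c * 1 * discount t (Suc j) i" for i by (simp add: disc)
  qed (assumption | rule second pos Suc.prems)+
  also have "\<dots> = ennreal (?c * odds N t (\<lambda>i. discount t (Suc j) i * discount t j i) w)"
    by (simp only: scale mult_1_right mult.assoc)
  also have "\<dots> \<le> ennreal (?c * (35 / 36 * odds N t (\<lambda>_. 1) w))"
    unfolding j_def by (intro ennreal_leI mult_left_mono discount_median_le Suc.prems t) auto
  also have "\<dots> = ennreal ((35 / 36) ^ Suc R * odds N t (\<lambda>_. 1) w)"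
    by (simp add: mult_ac)
  finally show ?case .
qed

lemma fails_le_locate:
  assumes answers: "\<And>t' g. 1 \<le> g \<Longrightarrow> g \<le> N \<Longrightarrow>
      2 / 3 \<le> pmf (Q t' (fst (qf g))) ((g \<le> t) = snd (qf g))"
    and t: "t \<le> N"
  shows "fails_le (locate N qf b) Q (\<lambda>r. r = t) (real N / 2 ^ b)"
  unfolding fails_le_def
proof (intro conjI allI)
  fix t'
  \<comment> \<open>25 rounds halve the expected odds, whence the factor 25 in
    \<open>locate\<close>; uniform weights start with odds \<open>N\<close>.\<close>
  have "((35 / 36) ^ 25 :: real) \<le> 1 / 2" by (simp add: power_divide)
  then have "((35 / 36) ^ 25 :: real) ^ b \<le> (1 / 2) ^ b" by (rule power_mono) simp
  then have "((35 / 36 :: real) ^ (25 * b)) * N \<le> 1 / 2 ^ b * N"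
    by (intro mult_right_mono) (simp_all add: power_mult power_one_over)
  moreover have "odds N t (\<lambda>_. 1) (\<lambda>_. 1) = N" using t by (simp add: odds_def)
  ultimately have "ennreal ((35 / 36) ^ (25 * b) * odds N t (\<lambda>_. 1) (\<lambda>_. 1)) \<le> ennreal (real N / 2 ^ b)"
    by (intro ennreal_leI) simp
  then show "ewp (locate N qf b) Q t' (\<lambda>r _. if r = t then 0 else 1) \<le> ennreal (real N / 2 ^ b)"
    unfolding locate_def
    by (rule order_trans[rotated]) (rule ewp_search_le[OF answers t], auto)
qed simp

section \<open>Sorting pivots and locating points\<close>

text \<open>Only strict comparisons are available. Threshold \<open>2 * j + 1\<close> stands for
  \<open>L ! j \<le> x\<close>, asked as the negation of \<open>x < L ! j\<close>, and
  \<open>2 * j + 2\<close> for \<open>L ! j < x\<close>. Together they tell equality with a list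
  entry from the gaps on either side.\<close>

definition threshold_query :: "nat \<Rightarrow> nat \<Rightarrow> nat list \<Rightarrow> nat \<Rightarrow> cmp_query \<times> bool" where
  "threshold_query i x L g =
     (if odd g then ((i, x, L ! (g div 2)), False) else ((i, L ! (g div 2 - 1), x), True))"

definition place_alg :: "nat \<Rightarrow> nat \<Rightarrow> nat list \<Rightarrow> nat \<Rightarrow> (cmp_query, nat) query_alg" where
  "place_alg b i L x = locate (2 * length L) (threshold_query i x L) b"

text \<open>Insertion sort. An odd position says that the value of \<open>x\<close> is already
  present; dropping \<open>x\<close> keeps the values strictly increasing.\<close>

primrec sort_alg :: "nat \<Rightarrow> nat \<Rightarrow> nat list \<Rightarrow> (cmp_query, nat list) query_alg" where
  "sort_alg b i [] = Return []"
| "sort_alg b i (x # xs) = bind_alg (sort_alg b i xs) (\<lambda>L. bind_alg (place_alg b i L x)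
     (\<lambda>p. Return (if odd p then L else take (p div 2) L @ x # drop (p div 2) L)))"

definition prepare :: "nat \<Rightarrow> nat \<Rightarrow> nat \<Rightarrow> nat list \<Rightarrow> (cmp_query, nat \<times> nat \<Rightarrow> nat) query_alg" where
  "prepare n d b ps = bind_alg (collect (\<lambda>i. sort_alg b i ps) [0..<d])
     (\<lambda>Ls. collect (\<lambda>(i, x). place_alg b i (Ls i) x) (List.product [0..<d] [0..<n]))"

text \<open>A search among two positions amplifies a single noisy comparison.\<close>

definition compare :: "nat \<Rightarrow> cmp_query \<Rightarrow> (cmp_query, nat) query_alg" where
  "compare b q = locate 1 (\<lambda>_. (q, True)) b"

definition learn :: "nat \<Rightarrow> nat \<Rightarrow> nat list \<Rightarrow> (cmp_query, cmp_query \<Rightarrow> bool) query_alg" where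
  "learn d b Y = bind_alg (collect (compare b) (List.product [0..<d] (List.product Y Y)))
     (\<lambda>g. Return (\<lambda>q. g q = 1))"

text \<open>The \<open>mod\<close> only matters outside the support: a \<open>Sample\<close> node has a branch for every natural
  number, and all of them count for the queries and outputs of the tree.\<close>

primrec draw :: "nat \<Rightarrow> nat \<Rightarrow> ('q, nat list) query_alg" where
  "draw n 0 = Return []"
| "draw n (Suc s) = bind_alg (draw n s)
     (\<lambda>ps. Sample (pmf_of_set {..<n}) (\<lambda>x. Return (x mod n # ps)))"

section \<open>Query bounds for drawing, sorting, placing and learning\<close>

lemma bounded_alg_draw:
  "0 < n \<Longrightarrow> bounded_alg (draw n s) S {ps. set ps \<subseteq> {..<n} \<and> length ps = s} 0"
  by (induction s) (auto intro!: bounded_alg_bind'[where c' = 0])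

lemma bounded_alg_place:
  assumes "i < d" "x < n" "set L \<subseteq> {..<n}" "length L \<le> s"
  shows "bounded_alg (place_alg b i L x) (cmp_queries n d) {..2 * s} (50 * b)"
proof -
  have "fst (threshold_query i x L g) \<in> cmp_queries n d" if "1 \<le> g" "g \<le> 2 * length L" for g
  proof -
    have "L ! (g div 2) \<in> set L" if "odd g"
      using \<open>g \<le> 2 * length L\<close> that by (intro nth_mem) (auto elim!: oddE)
    moreover have "L ! (g div 2 - 1) \<in> set L" if "even g"
      using \<open>g \<le> 2 * length L\<close> \<open>1 \<le> g\<close> that by (intro nth_mem) (auto elim!: evenE)
    ultimately show ?thesis using assms by (auto simp: threshold_query_def cmp_queries_def)
  qed
  then show ?thesis unfolding place_alg_def
    by (intro bounded_alg_mono[OF bounded_alg_locate]) (use assms in auto)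
qed

lemma bounded_alg_sort:
  assumes "i < d" "set ps \<subseteq> {..<n}"
  shows "bounded_alg (sort_alg b i ps) (cmp_queries n d)
      {L. set L \<subseteq> set ps \<and> length L \<le> length ps} (length ps * (50 * b))"
  using assms(2)
proof (induction ps)
  case (Cons x xs)
  have "bounded_alg (bind_alg (place_alg b i L x)
        (\<lambda>p. Return (if odd p then L else take (p div 2) L @ x # drop (p div 2) L)))
      (cmp_queries n d) {L. set L \<subseteq> set (x # xs) \<and> length L \<le> length (x # xs)} (50 * b + 0)"
    if "set L \<subseteq> set xs" "length L \<le> length xs" for L
    by (rule bounded_alg_bind[OF bounded_alg_place[where s = "length xs"]])
      (use assms(1) Cons.prems that in \<open>auto dest: in_set_takeD in_set_dropD\<close>)
  then show ?case
    unfolding sort_alg.simps using Cons.prems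
    by (intro bounded_alg_bind'[OF Cons.IH]) auto
qed simp

lemma bounded_alg_prepare:
  assumes "set ps \<subseteq> {..<n}" "length ps \<le> n"
  shows "bounded_alg (prepare n d b ps) (cmp_queries n d) UNIV (100 * n * d * b)"
proof -
  have sort: "bounded_alg (collect (\<lambda>i. sort_alg b i ps) [0..<d]) (cmp_queries n d)
      {Ls. \<forall>i\<in>set [0..<d]. Ls i \<in> {L. set L \<subseteq> set ps \<and> length L \<le> length ps}}
      (length [0..<d] * (length ps * (50 * b)))"
    by (intro bounded_alg_collect bounded_alg_sort) (use assms in auto)
  have place: "bounded_alg (collect (\<lambda>(i, x). place_alg b i (Ls i) x) (List.product [0..<d] [0..<n]))
      (cmp_queries n d) UNIV (d * n * (50 * b))"
    if "Ls \<in> {Ls. \<forall>i\<in>set [0..<d]. Ls i \<in> {L. set L \<subseteq> set ps \<and> length L \<le> length ps}}" for Ls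
  proof -
    have "bounded_alg (collect (\<lambda>(i, x). place_alg b i (Ls i) x) (List.product [0..<d] [0..<n]))
      (cmp_queries n d) {g. \<forall>q \<in> set (List.product [0..<d] [0..<n]). g q \<in> {..2 * n}}
      (length (List.product [0..<d] [0..<n]) * (50 * b))"
    proof (rule bounded_alg_collect)
      fix q assume "q \<in> set (List.product [0..<d] [0..<n])"
      then have q: "fst q < d" "snd q < n" by auto
      then have "set (Ls (fst q)) \<subseteq> set ps \<and> length (Ls (fst q)) \<le> length ps"
        using that by simp
      then have Ls: "set (Ls (fst q)) \<subseteq> {..<n}" "length (Ls (fst q)) \<le> n"
        using assms by auto
      show "bounded_alg ((\<lambda>(i, x). place_alg b i (Ls i) x) q) (cmp_queries n d) {..2 * n} (50 * b)"
        using bounded_alg_place[OF q Ls] by (simp add: case_prod_unfold)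
    qed
    then show ?thesis by (rule bounded_alg_mono) auto
  qed
  have total: "length [0..<d] * (length ps * (50 * b)) + d * n * (50 * b) \<le> 100 * n * d * b"
  proof -
    have "length [0..<d] * (length ps * (50 * b)) \<le> d * (n * (50 * b))"
      using assms by (intro mult_mono) auto
    then show ?thesis by (simp add: algebra_simps)
  qed
  show ?thesis unfolding prepare_def by (rule bounded_alg_bind'[OF sort place total])
qed

lemma bounded_alg_learn:
  assumes "set Y \<subseteq> {..<n}"
  shows "bounded_alg (learn d b Y) (cmp_queries n d) UNIV (50 * b * d * length Y ^ 2)"
proof -
  have "bounded_alg (collect (compare b) (List.product [0..<d] (List.product Y Y)))
      (cmp_queries n d) {g. \<forall>q \<in> set (List.product [0..<d] (List.product Y Y)). g q \<in> {..1}}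
      (length (List.product [0..<d] (List.product Y Y)) * (50 * b))"
    unfolding compare_def
    by (rule bounded_alg_collect, rule bounded_alg_locate)
      (use assms in \<open>auto simp: cmp_queries_def\<close>)
  then show ?thesis unfolding learn_def
    by (rule bounded_alg_bind'[where c' = 0]) (simp_all add: power2_eq_square mult_ac)
qed

text \<open>The rank of \<open>v\<close> is odd exactly if \<open>v \<in> V\<close>; even ranks stand for the gaps of \<open>V\<close>.\<close>

definition rank_in :: "real set \<Rightarrow> real \<Rightarrow> nat" where
  "rank_in V v = card {u \<in> V. u < v} + card {u \<in> V. u \<le> v}"

lemma card_le_eq:
  assumes "finite (V :: real set)"
  shows "card {u \<in> V. u \<le> v} = card {u \<in> V. u < v} + (if v \<in> V then 1 else 0)"
proof (cases "v \<in> V")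
  case True
  then have "{u \<in> V. u \<le> v} = insert v {u \<in> V. u < v}" by auto
  then show ?thesis using assms True by simp
next
  case False
  then have "{u \<in> V. u \<le> v} = {u \<in> V. u < v}" by (auto simp: le_less)
  then show ?thesis using False by simp
qed

lemma odd_rank_iff: "finite V \<Longrightarrow> odd (rank_in V v) \<longleftrightarrow> v \<in> V"
  by (simp add: rank_in_def card_le_eq)

lemma rank_mono: "finite V \<Longrightarrow> u \<le> v \<Longrightarrow> rank_in V u \<le> rank_in V v"
  unfolding rank_in_def by (intro add_mono card_mono) auto

lemma rank_less_imp: "finite V \<Longrightarrow> rank_in V u < rank_in V v \<Longrightarrow> u < v"
  using rank_mono[of V v u] by (meson not_le)

lemma rank_le: "finite V \<Longrightarrow> rank_in V v \<le> 2 * card V"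
  unfolding rank_in_def using card_mono[of V "{u \<in> V. u < v}"] card_mono[of V "{u \<in> V. u \<le> v}"]
  by auto

lemma rank_less_of_between:
  assumes "finite V" "r \<in> V" "u \<le> r" "r < v"
  shows "rank_in V u < rank_in V v"
proof -
  have "card {w \<in> V. w < u} < card {w \<in> V. w < v}"
  proof (rule psubset_card_mono)
    have "r \<in> {w \<in> V. w < v}" "r \<notin> {w \<in> V. w < u}" using assms by auto
    moreover have "{w \<in> V. w < u} \<subseteq> {w \<in> V. w < v}" using assms by auto
    ultimately show "{w \<in> V. w < u} \<subset> {w \<in> V. w < v}" by blast
  qed (use assms in simp)
  moreover have "card {w \<in> V. w \<le> u} \<le> card {w \<in> V. w \<le> v}"
    using assms by (intro card_mono) auto
  ultimately show ?thesis by (simp add: rank_in_def)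
qed

lemma rank_eq_odd:
  assumes "finite V" "rank_in V u = rank_in V v" "odd (rank_in V v)"
  shows "u = v"
proof (rule ccontr)
  assume "u \<noteq> v"
  have "u \<in> V" "v \<in> V" using assms by (auto simp flip: odd_rank_iff)
  then have "rank_in V u \<noteq> rank_in V v"
    using \<open>u \<noteq> v\<close> rank_less_of_between[OF assms(1), of u u v] rank_less_of_between[OF assms(1), of v v u]
    by (cases u v rule: linorder_cases) auto
  then show False using assms by simp
qed

text \<open>The indices whose values satisfy a downward closed \<open>P\<close> form an initial
  segment, so counting them decides whether \<open>j\<close> belongs to it.\<close>

lemma nth_iff_card:
  assumes vs: "sorted_wrt (<) (vs :: real list)" and j: "j < length vs"
    and down: "\<And>u v. u < v \<Longrightarrow> P v \<Longrightarrow> P u"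
  shows "P (vs ! j) \<longleftrightarrow> j < card {u \<in> set vs. P u}"
proof -
  let ?J = "{k. k < length vs \<and> P (vs ! k)}"
  have "distinct vs" using vs by (simp add: strict_sorted_iff)
  then have "inj_on ((!) vs) ?J" by (auto simp: inj_on_def nth_eq_iff_index_eq)
  moreover have "{u \<in> set vs. P u} = (!) vs ` ?J" by (auto simp: in_set_conv_nth)
  ultimately have card: "card {u \<in> set vs. P u} = card ?J" by (simp add: card_image)
  have fin: "finite ?J" by simp
  show ?thesis
  proof
    assume "P (vs ! j)"
    then have "k \<in> ?J" if "k \<le> j" for k
      using that j down[of "vs ! k" "vs ! j"] sorted_wrt_nth_less[OF vs, of k j]
      by (cases "k = j") auto
    then have "{..j} \<subseteq> ?J" by auto
    then show "j < card {u \<in> set vs. P u}" using card_mono[OF fin, of "{..j}"] card by simp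
  next
    assume less: "j < card {u \<in> set vs. P u}"
    show "P (vs ! j)"
    proof (rule ccontr)
      assume "\<not> P (vs ! j)"
      then have "k < j" if "k \<in> ?J" for k
        using that down[of "vs ! j" "vs ! k"] sorted_wrt_nth_less[OF vs, of j k]
        by (cases j k rule: linorder_cases) auto
      then have "?J \<subseteq> {..<j}" by auto
      then have "card ?J \<le> j" using card_mono[of "{..<j}" ?J] by simp
      then show False using less card by simp
    qed
  qed
qed

lemma rank_thresholds:
  assumes vs: "sorted_wrt (<) vs" and j: "j < length vs"
  shows "Suc (2 * j) \<le> rank_in (set vs) v \<longleftrightarrow> vs ! j \<le> v"
    and "Suc (Suc (2 * j)) \<le> rank_in (set vs) v \<longleftrightarrow> vs ! j < v"
  using nth_iff_card[OF vs j, of "\<lambda>u. u \<le> v"] nth_iff_card[OF vs j, of "\<lambda>u. u < v"]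
    card_le_eq[of "set vs" v]
  by (auto simp: rank_in_def split: if_splits)

definition coord_vals :: "(nat \<Rightarrow> point) \<Rightarrow> nat \<Rightarrow> nat set \<Rightarrow> real set" where
  "coord_vals pt i A = (\<lambda>y. pt y i) ` A"

text \<open>\<open>separated\<close> is what injectivity on extensional points becomes on the level
  of labels; it makes the lexicographic order total on the labels.\<close>

locale noisy_points =
  fixes n d :: nat and pt :: "nat \<Rightarrow> point" and Q :: "nat \<Rightarrow> cmp_query \<Rightarrow> bool pmf"
  assumes answers: "noisy_oracle n d pt Q"
    and separated: "x < n \<Longrightarrow> y < n \<Longrightarrow> (\<And>i. i < d \<Longrightarrow> pt x i = pt y i) \<Longrightarrow> x = y"
begin

definition sorted_at :: "nat \<Rightarrow> nat list \<Rightarrow> bool" where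
  "sorted_at i L \<longleftrightarrow> sorted_wrt (<) (map (\<lambda>y. pt y i) L)"

abbreviation true_rank :: "nat list \<Rightarrow> nat \<Rightarrow> nat \<Rightarrow> nat" where
  "true_rank ps i x \<equiv> rank_in (coord_vals pt i (set ps)) (pt x i)"

definition truth :: "cmp_query \<Rightarrow> bool" where
  "truth = (\<lambda>(i, x, y). pt x i < pt y i)"

lemma answers_truth:
  "i < d \<Longrightarrow> x < n \<Longrightarrow> y < n \<Longrightarrow> 2 / 3 \<le> pmf (Q t (i, x, y)) (pt x i < pt y i)"
  using answers by (auto simp: noisy_oracle_def cmp_queries_def)

lemma fails_le_place:
  assumes i: "i < d" and x: "x < n" and L: "set L \<subseteq> {..<n}" "sorted_at i L"
    and s: "length L \<le> s"
  shows "fails_le (place_alg b i L x) Q (\<lambda>r. r = true_rank L i x) (real (2 * s) / 2 ^ b)"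
proof (rule fails_le_mono)
  let ?vs = "map (\<lambda>y. pt y i) L" and ?v = "pt x i"
  have vs: "sorted_wrt (<) ?vs" using L by (simp add: sorted_at_def)
  have V: "coord_vals pt i (set L) = set ?vs" by (simp add: coord_vals_def)
  show "fails_le (place_alg b i L x) Q (\<lambda>r. r = true_rank L i x) (real (2 * length L) / 2 ^ b)"
    unfolding place_alg_def
  proof (rule fails_le_locate)
    fix t g assume g: "1 \<le> g" "g \<le> 2 * length L"
    show "2 / 3 \<le> pmf (Q t (fst (threshold_query i x L g)))
        ((g \<le> true_rank L i x) = snd (threshold_query i x L g))"
    proof (cases "odd g")
      case True
      then obtain j where j: "g = Suc (2 * j)" "j < length L" using g by (auto elim!: oddE)
      then have "L ! j < n" using subsetD[OF L(1) nth_mem[OF j(2)]] by simp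
      moreover have "g \<le> true_rank L i x \<longleftrightarrow> \<not> ?v < pt (L ! j) i"
        using rank_thresholds(1)[OF vs, of j ?v] j unfolding V by (simp add: not_less)
      ultimately show ?thesis
        using answers_truth[OF i x, of "L ! j" t] j by (simp add: threshold_query_def)
    next
      case False
      then obtain j where j: "g = Suc (Suc (2 * j))" "j < length L"
        using g by (auto elim!: evenE) (metis Suc_1 Suc_le_lessD Suc_pred mult_Suc_right add_2_eq_Suc less_eq_Suc_le)
      then have "L ! j < n" using subsetD[OF L(1) nth_mem[OF j(2)]] by simp
      moreover have "g \<le> true_rank L i x \<longleftrightarrow> pt (L ! j) i < ?v"
        using rank_thresholds(2)[OF vs, of j ?v] j unfolding V by simp
      ultimately show ?thesis
        using answers_truth[OF i _ x, of "L ! j" t] j by (simp add: threshold_query_def)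
    qed
  next
    have "card (coord_vals pt i (set L)) \<le> length L"
      unfolding V using card_length[of ?vs] by simp
    then show "true_rank L i x \<le> 2 * length L"
      using rank_le[of "coord_vals pt i (set L)" ?v] by (simp add: coord_vals_def)
  qed
  show "real (2 * length L) / 2 ^ b \<le> real (2 * s) / 2 ^ b"
    using s by (intro divide_right_mono) auto
qed

text \<open>An even \<open>p\<close> says that no value ties with that of \<open>x\<close> and that
  exactly \<open>p div 2\<close> values lie below it. The second claim concerns values rather than
  labels, because a tied label is represented by the one already in the list.\<close>

lemma insert_at_rank:
  fixes x :: nat
  assumes L: "sorted_at i L"
  defines "p \<equiv> true_rank L i x"
  defines "L' \<equiv> if odd p then L else take (p div 2) L @ x # drop (p div 2) L"
  shows "sorted_at i L'" and "coord_vals pt i (set L') = coord_vals pt i (insert x (set L))"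
proof -
  let ?vs = "map (\<lambda>y. pt y i) L" and ?v = "pt x i"
  have vs: "sorted_wrt (<) ?vs" using L by (simp add: sorted_at_def)
  have V: "coord_vals pt i (set L) = set ?vs" by (simp add: coord_vals_def)
  have fin: "finite (coord_vals pt i (set L))" by (simp add: coord_vals_def)
  have odd: "odd p \<longleftrightarrow> ?v \<in> set ?vs" unfolding p_def using odd_rank_iff[OF fin] V by simp
  show "coord_vals pt i (set L') = coord_vals pt i (insert x (set L))"
  proof (cases "odd p")
    case True
    then show ?thesis using odd unfolding L'_def by (auto simp: coord_vals_def image_iff)
  next
    case False
    have "set L = set (take (p div 2) L) \<union> set (drop (p div 2) L)"
      by (metis append_take_drop_id set_append)
    then have "set L' = insert x (set L)" using False by (simp add: L'_def)
    then show ?thesis by simp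
  qed
  show "sorted_at i L'"
  proof (cases "odd p")
    case True
    then show ?thesis using L by (simp add: L'_def)
  next
    case False
    let ?a = "p div 2"
    have p: "p = 2 * ?a" using False by simp
    have below: "pt y i < ?v" if y: "y \<in> set (take ?a L)" for y
    proof -
      obtain j where j: "j < ?a" "j < length L" "y = L ! j"
        using y by (auto simp: in_set_conv_nth)
      then have "Suc (Suc (2 * j)) \<le> p" using p by linarith
      then show ?thesis using rank_thresholds(2)[OF vs, of j ?v] j by (simp add: p_def V)
    qed
    have above: "?v < pt y i" if y: "y \<in> set (drop ?a L)" for y
    proof -
      obtain j where j: "?a \<le> j" "j < length L" "y = L ! j"
        using y by (auto simp: in_set_conv_nth) (metis add.commute le_add1 less_diff_conv)
      then have "\<not> Suc (2 * j) \<le> p" using p by linarith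
      then show ?thesis using rank_thresholds(1)[OF vs, of j ?v] j by (simp add: p_def V)
    qed
    have "sorted_wrt (\<lambda>y z. pt y i < pt z i) (take ?a L @ drop ?a L)"
      using L by (simp add: sorted_at_def sorted_wrt_map)
    from this[unfolded sorted_wrt_append] show ?thesis
      using False below above unfolding L'_def sorted_at_def sorted_wrt_map
      by (auto simp: sorted_wrt_append)
  qed
qed

lemma fails_le_sort:
  assumes i: "i < d" and ps: "set ps \<subseteq> {..<n}" and s: "length ps \<le> s"
  shows "fails_le (sort_alg b i ps) Q
     (\<lambda>L. sorted_at i L \<and> coord_vals pt i (set L) = coord_vals pt i (set ps))
     (real (length ps) * (real (2 * s) / 2 ^ b))"
  using ps s
proof (induction ps)
  case Nil
  then show ?case by (simp add: fails_le_Return sorted_at_def)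
next
  case (Cons x xs)
  let ?e = "real (2 * s) / 2 ^ b"
  have outs: "set L \<subseteq> set xs \<and> length L \<le> length xs" if "L \<in> outputs (sort_alg b i xs)" for L
    using that bounded_alg_outputs[OF bounded_alg_sort[OF i, of xs n b]] Cons.prems by auto
  show ?case
    unfolding sort_alg.simps
  proof (rule fails_le_bind)
    show "fails_le (sort_alg b i xs) Q
       (\<lambda>L. sorted_at i L \<and> coord_vals pt i (set L) = coord_vals pt i (set xs))
       (real (length xs) * ?e)"
      by (rule Cons.IH) (use Cons.prems in auto)
    show "real (length xs) * ?e + ?e \<le> real (length (x # xs)) * ?e"
      by (simp only: length_Cons of_nat_Suc distrib_right mult_1_left add.commute order_refl)
    show "0 \<le> ?e" by simp
    fix L assume L: "L \<in> outputs (sort_alg b i xs)"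
      "sorted_at i L \<and> coord_vals pt i (set L) = coord_vals pt i (set xs)"
    show "fails_le (bind_alg (place_alg b i L x)
          (\<lambda>p. Return (if odd p then L else take (p div 2) L @ x # drop (p div 2) L))) Q
        (\<lambda>L. sorted_at i L \<and> coord_vals pt i (set L) = coord_vals pt i (set (x # xs))) ?e"
    proof (rule fails_le_bind)
      show "fails_le (place_alg b i L x) Q (\<lambda>r. r = true_rank L i x) ?e"
        by (rule fails_le_place) (use i Cons.prems outs[OF L(1)] L(2) in auto)
      fix p assume p: "p = true_rank L i x"
      have "coord_vals pt i (insert x (set L)) = coord_vals pt i (set (x # xs))"
        using L(2) by (simp add: coord_vals_def)
      then show "fails_le (Return (if odd p then L else take (p div 2) L @ x # drop (p div 2) L)) Q
          (\<lambda>L. sorted_at i L \<and> coord_vals pt i (set L) = coord_vals pt i (set (x # xs))) 0"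
        using insert_at_rank[of i L x] L(2) unfolding p by (intro fails_le_Return) auto
    qed simp_all
  qed
qed

text \<open>The weights are left open to serve two purposes: constant weight 1 gives that all ranks
  are right, as \<open>sort_all\<close> requires, and mixed weights give
  \<open>good_ranks\<close>.\<close>

lemma fails_le_prepare:
  fixes c :: "nat \<Rightarrow> real"
  assumes ps: "set ps \<subseteq> {..<n}" "length ps \<le> s"
    and c: "\<And>x. 0 \<le> c x"
    and P: "\<And>B. (\<Sum>(i, x)\<in>{..<d} \<times> {..<n}. ennreal (c x) * (if B (i, x) = true_rank ps i x then 0 else 1)) < 1
        \<Longrightarrow> P B"
  shows "fails_le (prepare n d b ps) Q P
     ((real s + (\<Sum>x<n. c x)) * real d * (real (2 * s) / 2 ^ b))"
  unfolding prepare_def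
proof (rule fails_le_bind)
  let ?e = "real (2 * s) / 2 ^ b"
  let ?qs = "List.product [0..<d] [0..<n]"
  let ?good = "\<lambda>i L. set L \<subseteq> {..<n} \<and> length L \<le> s \<and> sorted_at i L
      \<and> coord_vals pt i (set L) = coord_vals pt i (set ps)"
  have "fails_le (sort_alg b i ps) Q (?good i) (real s * ?e)" if "i < d" for i
  proof (rule fails_le_mono[OF fails_le_sort[OF that ps]])
    show "real (length ps) * ?e \<le> real s * ?e" using ps by (intro mult_right_mono) auto
    show "?good i L" if "L \<in> outputs (sort_alg b i ps)"
      "sorted_at i L \<and> coord_vals pt i (set L) = coord_vals pt i (set ps)" for L
      using that ps bounded_alg_outputs[OF bounded_alg_sort[OF \<open>i < d\<close> ps(1), of b]] by auto
  qed
  then show "fails_le (collect (\<lambda>i. sort_alg b i ps) [0..<d]) Q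
      (\<lambda>Ls. \<forall>i\<in>set [0..<d]. ?good i (Ls i)) (real (length [0..<d]) * (real s * ?e))"
    by (intro fails_le_collect) auto
  show "0 \<le> sum_list (map (\<lambda>q. c (snd q)) ?qs) * ?e"
    by (intro mult_nonneg_nonneg sum_list_nonneg) (use c in auto)
  have "sum_list (map (\<lambda>q. c (snd q)) ?qs) = (\<Sum>q\<in>{..<d} \<times> {..<n}. c (snd q))"
    by (subst sum_list_distinct_conv_sum_set) (auto simp: distinct_product intro!: sum.cong)
  also have "\<dots> = real d * (\<Sum>x<n. c x)"
    using sum.cartesian_product[of "\<lambda>_ x. c x" "{..<n}" "{..<d}"]
    by (simp add: case_prod_unfold)
  finally show "real (length [0..<d]) * (real s * ?e) + sum_list (map (\<lambda>q. c (snd q)) ?qs) * ?e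
      \<le> (real s + (\<Sum>x<n. c x)) * real d * ?e"
    by (simp add: algebra_simps)
  fix Ls assume "\<forall>i\<in>set [0..<d]. ?good i (Ls i)"
  then have good: "?good i (Ls i)" if "i < d" for i using that by auto
  let ?P = "\<lambda>q r. r = true_rank ps (fst q) (snd q)"
  show "fails_le (collect (\<lambda>(i, x). place_alg b i (Ls i) x) ?qs) Q P
      (sum_list (map (\<lambda>q. c (snd q)) ?qs) * ?e)"
  proof (rule fails_le_markov[where
      f = "\<lambda>B. \<Sum>q\<in>set ?qs. ennreal (c (snd q)) * (if ?P q (B q) then 0 else 1)"])
    show "ewp (collect (\<lambda>(i, x). place_alg b i (Ls i) x) ?qs) Q t
        (\<lambda>B _. \<Sum>q\<in>set ?qs. ennreal (c (snd q)) * (if ?P q (B q) then 0 else 1))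
      \<le> ennreal (sum_list (map (\<lambda>q. c (snd q)) ?qs) * ?e)" for t
    proof (rule ewp_collect_le[where P = ?P and c = "\<lambda>q. c (snd q)"])
      fix q assume "q \<in> set ?qs"
      then have q: "fst q < d" "snd q < n" by auto
      then show "fails_le ((\<lambda>(i, x). place_alg b i (Ls i) x) q) Q (?P q) ?e"
        using fails_le_place[OF q, of "Ls (fst q)" s b] good[OF q(1)]
        by (simp add: case_prod_unfold)
    qed (use c in auto)
    show "0 \<le> sum_list (map (\<lambda>q. c (snd q)) ?qs) * ?e"
      by (intro mult_nonneg_nonneg sum_list_nonneg) (use c in auto)
    fix B :: "nat \<times> nat \<Rightarrow> nat"
    assume less: "(\<Sum>q\<in>set ?qs. ennreal (c (snd q)) * (if ?P q (B q) then 0 else 1)) < 1"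
    have "set ?qs = {..<d} \<times> {..<n}" by auto
    then show "P B" using less by (intro P) (simp add: case_prod_unfold)
  qed
qed

lemma fails_le_learn:
  assumes "set Y \<subseteq> {..<n}" "length Y \<le> k"
  shows "fails_le (learn d b Y) Q
     (\<lambda>g. \<forall>i<d. \<forall>x\<in>set Y. \<forall>y\<in>set Y. g (i, x, y) = truth (i, x, y)) (real (d * k ^ 2) / 2 ^ b)"
  unfolding learn_def
proof (rule fails_le_bind)
  let ?qs = "List.product [0..<d] (List.product Y Y)"
  show "fails_le (collect (compare b) ?qs) Q
      (\<lambda>g. \<forall>q\<in>set ?qs. g q = of_bool (truth q)) (real (length ?qs) * (1 / 2 ^ b))"
  proof (rule fails_le_collect)
    fix q assume "q \<in> set ?qs"
    then obtain i x y where q: "q = (i, x, y)" "i < d" and "x \<in> set Y" "y \<in> set Y"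
      by auto
    then have xy: "x < n" "y < n" using assms by auto
    have "fails_le (compare b q) Q (\<lambda>r. r = of_bool (truth q)) (real 1 / 2 ^ b)"
      unfolding compare_def
    proof (rule fails_le_locate)
      show "2 / 3 \<le> pmf (Q t (fst (q, True))) ((g \<le> of_bool (truth q)) = snd (q, True))"
        if "1 \<le> g" "g \<le> 1" for t and g :: nat
      proof -
        have "(g \<le> of_bool (truth q)) = (pt x i < pt y i)"
          using that by (auto simp: truth_def q)
        then show ?thesis using answers_truth[OF q(2) xy, of t] by (simp add: q)
      qed
    qed simp
    then show "fails_le (compare b q) Q (\<lambda>r. r = of_bool (truth q)) (1 / 2 ^ b)" by simp
  qed simp
  show "fails_le (Return (\<lambda>q. g q = 1)) Q
      (\<lambda>g. \<forall>i<d. \<forall>x\<in>set Y. \<forall>y\<in>set Y. g (i, x, y) = truth (i, x, y)) 0"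
    if "\<forall>q\<in>set ?qs. g q = of_bool (truth q)" for g :: "cmp_query \<Rightarrow> nat"
    using that by (intro fails_le_Return) auto
  have "length Y * length Y \<le> k * k" using assms by (intro mult_mono) auto
  then have "real (length ?qs) \<le> real (d * k ^ 2)"
    unfolding power2_eq_square by (intro of_nat_mono) simp
  then show "real (length ?qs) * (1 / 2 ^ b) + 0 \<le> real (d * k ^ 2) / 2 ^ b"
    by (simp add: divide_right_mono)
qed simp

end

lemma fails_le_draw:
  assumes n: "0 < n" and H: "H \<subseteq> {..<n}"
  shows "fails_le (draw n s) Q (\<lambda>ps. set ps \<inter> H \<noteq> {}) ((1 - real (card H) / real n) ^ s)"
proof -
  let ?p = "1 - real (card H) / real n"
  have "card H \<le> n" using card_mono[OF _ H] by simp
  then have p: "0 \<le> ?p" using n by (simp add: field_simps)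
  have "ewp (draw n s) Q t (\<lambda>ps _. if set ps \<inter> H \<noteq> {} then 0 else 1) \<le> ennreal (?p ^ s)" for t
  proof (induction s arbitrary: t)
    case (Suc s)
    let ?f = "\<lambda>ps. if set ps \<inter> H \<noteq> {} then 0 else (1 :: ennreal)"
    have miss: "(\<integral>\<^sup>+ x. ?f (x mod n # ps) \<partial>measure_pmf (pmf_of_set {..<n})) \<le> ennreal ?p * ?f ps" for ps
    proof -
      have "(\<integral>\<^sup>+ x. ?f (x mod n # ps) \<partial>measure_pmf (pmf_of_set {..<n}))
          = (\<integral>\<^sup>+ x. indicator ({..<n} - H) x * ?f ps \<partial>measure_pmf (pmf_of_set {..<n}))"
        using n by (intro nn_integral_cong_AE) (auto simp: AE_measure_pmf_iff lessThan_empty_iff)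
      also have "\<dots> = emeasure (measure_pmf (pmf_of_set {..<n})) ({..<n} - H) * ?f ps"
        by (simp add: nn_integral_multc)
      also have "emeasure (measure_pmf (pmf_of_set {..<n})) ({..<n} - H) = ennreal ?p"
      proof -
        have "card ({..<n} \<inter> ({..<n} - H)) = n - card H"
          using H by (simp add: card_Diff_subset finite_subset Int_absorb1)
        then show ?thesis using n \<open>card H \<le> n\<close>
          by (subst emeasure_pmf_of_set) (auto simp: lessThan_empty_iff of_nat_diff diff_divide_distrib)
      qed
      finally show ?thesis by simp
    qed
    have "ewp (draw n (Suc s)) Q t (\<lambda>ps _. ?f ps)
        \<le> ewp (draw n s) Q t (\<lambda>ps _. ennreal ?p * ?f ps)"
      unfolding draw.simps ewp_bind ewp.simps by (rule ewp_mono) (rule miss)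
    also have "\<dots> \<le> ennreal ?p * ennreal (?p ^ s)"
      unfolding ewp_cmult by (intro mult_left_mono Suc.IH) auto
    finally show ?case using p by (simp add: ennreal_mult)
  qed simp
  then show ?thesis using p by (simp add: fails_le_def)
qed

section \<open>Extracting skyline points by tournaments\<close>

primrec tournament :: "(nat \<Rightarrow> 'a \<Rightarrow> 'a \<Rightarrow> ('q, 'a) query_alg) \<Rightarrow> nat \<Rightarrow> 'a list \<Rightarrow>
    ('q, 'a) query_alg" where
  "tournament m 0 xs = Return (hd xs)"
| "tournament m (Suc h) xs = (if length xs \<le> 2 ^ h then tournament m h xs
     else bind_alg (tournament m h (take (2 ^ h) xs))
       (\<lambda>x. bind_alg (tournament m h (drop (2 ^ h) xs)) (\<lambda>y. m (Suc h) x y)))"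

text \<open>Level \<open>l\<close> has at most 2^(h - l) matches, and the series of l / 2^l sums to
  2, so the higher precision near the root costs only a constant factor.\<close>

lemma bounded_alg_tournament:
  assumes m: "\<And>l x y. x \<in> V \<Longrightarrow> y \<in> V \<Longrightarrow> bounded_alg (m l x y) S V (\<alpha> + \<beta> * l)"
    and xs: "xs \<noteq> []" "set xs \<subseteq> V"
  shows "bounded_alg (tournament m h xs) S V ((\<alpha> + 2 * \<beta>) * 2 ^ h)"
proof -
  \<comment> \<open>The exact solution of the recurrence
    \<open>c' = 2 * c + \<alpha> + \<beta> * Suc h\<close> with \<open>c = 0\<close> at height 0,
    written without subtraction.\<close>
  have "\<exists>c. c + \<alpha> + \<beta> * h + 2 * \<beta> = (\<alpha> + 2 * \<beta>) * 2 ^ h \<and>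
      (\<forall>xs. xs \<noteq> [] \<longrightarrow> set xs \<subseteq> V \<longrightarrow> bounded_alg (tournament m h xs) S V c)"
  proof (induction h)
    case 0
    show ?case by (rule exI[of _ 0]) auto
  next
    case (Suc h)
    then obtain c where c: "c + \<alpha> + \<beta> * h + 2 * \<beta> = (\<alpha> + 2 * \<beta>) * 2 ^ h"
      and IH: "\<And>xs. xs \<noteq> [] \<Longrightarrow> set xs \<subseteq> V \<Longrightarrow> bounded_alg (tournament m h xs) S V c" by auto
    let ?c = "c + (c + (\<alpha> + \<beta> * Suc h))"
    have "bounded_alg (tournament m (Suc h) xs) S V ?c" if xs: "xs \<noteq> []" "set xs \<subseteq> V" for xs
    proof (cases "length xs \<le> 2 ^ h")
      case True
      then show ?thesis using bounded_alg_mono[OF IH[OF xs] subset_refl, of ?c] by simp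
    next
      case False
      have "set (take (2 ^ h) xs) \<subseteq> V" "set (drop (2 ^ h) xs) \<subseteq> V"
        using xs by (auto dest: in_set_takeD in_set_dropD)
      then have "bounded_alg (bind_alg (tournament m h (take (2 ^ h) xs))
         (\<lambda>x. bind_alg (tournament m h (drop (2 ^ h) xs)) (\<lambda>y. m (Suc h) x y))) S V ?c"
        using False xs by (intro bounded_alg_bind[where R = V] IH m) auto
      then show ?thesis using False by simp
    qed
    moreover have "?c + \<alpha> + \<beta> * Suc h + 2 * \<beta> = (\<alpha> + 2 * \<beta>) * 2 ^ Suc h"
      using c by (simp add: algebra_simps)
    ultimately show ?case by blast
  qed
  then obtain c where "c \<le> (\<alpha> + 2 * \<beta>) * 2 ^ h" "bounded_alg (tournament m h xs) S V c"
    using xs by (metis add.assoc le_add1)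
  then show ?thesis using bounded_alg_mono by blast
qed

text \<open>Only the matches of \<open>q\<close> matter, and their error probabilities form a geometric series.\<close>

lemma fails_le_tournament:
  assumes m: "\<And>l x y. x \<in> V \<Longrightarrow> y \<in> V \<Longrightarrow> bounded_alg (m l x y) S V (\<alpha> + \<beta> * l)"
    and win: "\<And>l x y. x \<in> V \<Longrightarrow> y \<in> V \<Longrightarrow> x = q \<or> y = q \<Longrightarrow>
       fails_le (m l x y) Q (\<lambda>r. r = q) (e / 2 ^ l)"
    and e: "0 \<le> e" and xs: "q \<in> set xs" "set xs \<subseteq> V" "length xs \<le> 2 ^ h"
  shows "fails_le (tournament m h xs) Q (\<lambda>r. r = q) (e * (1 - 1 / 2 ^ h))"
  using xs
proof (induction h arbitrary: xs)
  case 0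
  then have "xs = [q]" by (cases xs) auto
  then show ?case by (simp add: fails_le_Return)
next
  case (Suc h)
  have pow: "e * (1 - 1 / 2 ^ h) + e / 2 ^ Suc h = e * (1 - 1 / 2 ^ Suc h)"
    by (simp add: field_simps)
  have nonneg: "0 \<le> e / 2 ^ Suc h" "0 \<le> e * (1 - 1 / 2 ^ h)"
    using e by (auto intro!: mult_nonneg_nonneg simp: divide_le_eq)
  show ?case
  proof (cases "length xs \<le> 2 ^ h")
    case True
    then have IH: "fails_le (tournament m h xs) Q (\<lambda>r. r = q) (e * (1 - 1 / 2 ^ h))"
      using Suc by auto
    have "e * (1 - 1 / 2 ^ h) \<le> e * (1 - 1 / 2 ^ Suc h)"
      using pow nonneg(1) by linarith
    from fails_le_mono[OF IH _ this] show ?thesis using True by simp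
  next
    case False
    let ?l = "take (2 ^ h) xs" and ?r = "drop (2 ^ h) xs"
    have sets: "set ?l \<subseteq> V" "set ?r \<subseteq> V"
      using Suc.prems by (auto dest: in_set_takeD in_set_dropD)
    have ne: "?l \<noteq> []" "?r \<noteq> []" using False by auto
    have outs: "outputs (tournament m h ys) \<subseteq> V" if "ys \<noteq> []" "set ys \<subseteq> V" for ys
      by (rule bounded_alg_outputs[OF bounded_alg_tournament[where m = m, OF m that]])
    have outs: "x \<in> V" if "x \<in> outputs (tournament m h ?l) \<or> x \<in> outputs (tournament m h ?r)" for x
      using that outs[OF ne(1) sets(1)] outs[OF ne(2) sets(2)] by auto
    have trivial: "fails_le A Q (\<lambda>_. True) 0" for A :: "('b, 'a) query_alg"
      by (simp add: fails_le_def ewp_const)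
    have "q \<in> set ?l \<or> q \<in> set ?r"
      using Suc.prems by (metis Un_iff append_take_drop_id set_append)
    then have "fails_le (bind_alg (tournament m h ?l)
         (\<lambda>x. bind_alg (tournament m h ?r) (\<lambda>y. m (Suc h) x y))) Q (\<lambda>r. r = q)
         (e * (1 - 1 / 2 ^ h) + e / 2 ^ Suc h)"
    proof
      assume "q \<in> set ?l"
      then have "fails_le (tournament m h ?l) Q (\<lambda>r. r = q) (e * (1 - 1 / 2 ^ h))"
        using Suc sets by auto
      then show ?thesis
      proof (rule fails_le_bind)
        fix x assume x: "x \<in> outputs (tournament m h ?l)" "x = q"
        show "fails_le (bind_alg (tournament m h ?r) (\<lambda>y. m (Suc h) x y)) Q (\<lambda>r. r = q) (e / 2 ^ Suc h)"
        proof (rule fails_le_bind[OF trivial])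
          show "fails_le (m (Suc h) x y) Q (\<lambda>r. r = q) (e / 2 ^ Suc h)"
            if "y \<in> outputs (tournament m h ?r)" for y
            by (rule win) (use x outs that in auto)
        qed (use nonneg in auto)
      qed (use nonneg in auto)
    next
      assume "q \<in> set ?r"
      then have right: "fails_le (tournament m h ?r) Q (\<lambda>r. r = q) (e * (1 - 1 / 2 ^ h))"
        using Suc sets by auto
      show ?thesis
      proof (rule fails_le_bind[OF trivial])
        fix x assume x: "x \<in> outputs (tournament m h ?l)"
        show "fails_le (bind_alg (tournament m h ?r) (\<lambda>y. m (Suc h) x y)) Q (\<lambda>r. r = q)
            (e * (1 - 1 / 2 ^ h) + e / 2 ^ Suc h)"
        proof (rule fails_le_bind[OF right])
          show "fails_le (m (Suc h) x y) Q (\<lambda>r. r = q) (e / 2 ^ Suc h)"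
            if "y \<in> outputs (tournament m h ?r)" "y = q" for y
            by (rule win) (use x outs that in auto)
        qed (use nonneg in auto)
      qed (use nonneg in auto)
    qed
    then show ?thesis using False pow by simp
  qed
qed

section \<open>Lexicographic order, matches and candidates\<close>

definition lexless :: "nat \<Rightarrow> (nat \<Rightarrow> 'a::linorder) \<Rightarrow> (nat \<Rightarrow> 'a) \<Rightarrow> bool" where
  "lexless d u v \<longleftrightarrow> (\<exists>i<d. u i < v i \<and> (\<forall>j<i. u j = v j))"

lemma lexless_irrefl: "\<not> lexless d u u"
  by (simp add: lexless_def)

lemma lexless_trans: "lexless d u v \<Longrightarrow> lexless d v w \<Longrightarrow> lexless d u w"
proof -
  assume "lexless d u v" "lexless d v w"
  then obtain i j where i: "i < d" "u i < v i" "\<forall>k<i. u k = v k"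
    and j: "j < d" "v j < w j" "\<forall>k<j. v k = w k"
    by (auto simp: lexless_def)
  show "lexless d u w"
  proof (cases i j rule: linorder_cases)
    case less
    then show ?thesis using i j unfolding lexless_def by (intro exI[of _ i]) auto
  next
    case equal
    then show ?thesis using i j unfolding lexless_def by (intro exI[of _ i]) auto
  next
    case greater
    then show ?thesis using i j unfolding lexless_def by (intro exI[of _ j]) auto
  qed
qed

lemma lexless_total:
  assumes "i < d" "u i \<noteq> v i"
  shows "lexless d u v \<or> lexless d v u"
proof -
  define k where "k = (LEAST k. u k \<noteq> v k)"
  have ne: "u k \<noteq> v k" unfolding k_def by (rule LeastI[of "\<lambda>k. u k \<noteq> v k", OF assms(2)])
  have eq: "u j = v j" if "j < k" for j using that not_less_Least unfolding k_def by blast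
  have "k \<le> i" unfolding k_def by (rule Least_le[of "\<lambda>k. u k \<noteq> v k", OF assms(2)])
  then have "k < d" using assms(1) by simp
  show ?thesis
  proof (cases "u k" "v k" rule: linorder_cases)
    case less
    then have "lexless d u v" using \<open>k < d\<close> eq unfolding lexless_def by blast
    then show ?thesis ..
  next
    case greater
    then have "lexless d v u" using \<open>k < d\<close> eq[symmetric] unfolding lexless_def by blast
    then show ?thesis ..
  qed (use ne in simp)
qed

text \<open>With the true table this is weak domination, so the points of \<open>F\<close> are
  covered by themselves and are never extracted twice.\<close>

definition covered :: "nat \<Rightarrow> (cmp_query \<Rightarrow> bool) \<Rightarrow> nat list \<Rightarrow> nat \<Rightarrow> bool" where
  "covered d g F x \<longleftrightarrow> (\<exists>f\<in>set F. \<forall>i<d. \<not> g (i, f, x))"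

definition table_lexless :: "nat \<Rightarrow> (cmp_query \<Rightarrow> bool) \<Rightarrow> nat \<Rightarrow> nat \<Rightarrow> bool" where
  "table_lexless d g x y \<longleftrightarrow> (\<exists>i<d. g (i, x, y) \<and> (\<forall>j<i. \<not> g (j, x, y) \<and> \<not> g (j, y, x)))"

text \<open>Coverage is decided by fresh comparisons and not by ranks, which say nothing within a
  gap. The precision \<open>b + l\<close> supplies the geometric series of error probabilities in
  the tournament.\<close>

definition match_alg :: "nat \<Rightarrow> nat \<Rightarrow> nat list \<Rightarrow> nat \<Rightarrow> nat \<Rightarrow> nat \<Rightarrow> (cmp_query, nat) query_alg" where
  "match_alg d b F l x y = bind_alg (learn d (b + l) (x # y # F)) (\<lambda>g. Return
     (if covered d g F x then y else if covered d g F y then x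
      else if table_lexless d g x y then y else x))"

text \<open>A certificate of domination read off the ranks. Equal odd ranks mean equal values; equal
  even ranks leave the order open, so a point that shares a gap with \<open>f\<close> is
  kept.\<close>

definition eliminated :: "nat \<Rightarrow> (nat \<times> nat \<Rightarrow> nat) \<Rightarrow> nat list \<Rightarrow> nat \<Rightarrow> bool" where
  "eliminated d B F x \<longleftrightarrow>
     (\<exists>f\<in>set F. \<forall>i<d. B (i, x) < B (i, f) \<or> B (i, x) = B (i, f) \<and> odd (B (i, f)))"

text \<open>A point qualifies through the number of survivors not below it, itself included. Points
  with equal rank vectors count for each other, so ties are never broken arbitrarily.\<close>

definition candidates :: "nat \<Rightarrow> nat \<Rightarrow> nat \<Rightarrow> (nat \<times> nat \<Rightarrow> nat) \<Rightarrow> nat list \<Rightarrow> nat set" where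
  "candidates n d h B F = (let A = {x. x < n \<and> \<not> eliminated d B F x} in
     {x \<in> A. card {y \<in> A. \<not> lexless d (\<lambda>i. B (i, y)) (\<lambda>i. B (i, x))} \<le> 2 ^ h})"

text \<open>Once all points are covered, so is every winner, and the check of the winner notices the
  end. This takes an additional round, so \<open>k\<close> rounds serve a skyline of fewer than
  \<open>k\<close> points when \<open>F\<close> is empty.\<close>

primrec sky_loop :: "nat \<Rightarrow> nat \<Rightarrow> nat \<Rightarrow> nat \<Rightarrow> (nat \<times> nat \<Rightarrow> nat) \<Rightarrow> nat \<Rightarrow> nat list \<Rightarrow>
    (cmp_query, nat set option) query_alg" where
  "sky_loop n d b h B 0 F = Return None"
| "sky_loop n d b h B (Suc k) F =
    (let xs = sorted_list_of_set (candidates n d h B F) in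
     if xs = [] then Return (Some (set F))
     else bind_alg (tournament (match_alg d b F) h xs) (\<lambda>w.
       bind_alg (learn d b (w # F)) (\<lambda>g.
         if covered d g F w then Return (Some (set F)) else sky_loop n d b h B k (w # F))))"

lemma finite_candidates: "finite (candidates n d h B F)"
  by (simp add: candidates_def)

lemma candidates_subset: "candidates n d h B F \<subseteq> {..<n}"
  by (auto simp: candidates_def Let_def)

text \<open>All candidates are among the points not below the lexicographically smallest candidate,
  and these are at most \<open>2 ^ h\<close>.\<close>

lemma card_candidates: "card (candidates n d h B F) \<le> 2 ^ h"
proof (cases "candidates n d h B F = {}")
  case False
  define A where "A = {x. x < n \<and> \<not> eliminated d B F x}"
  let ?T = "candidates n d h B F"
  let ?R = "\<lambda>y x. lexless d (\<lambda>i. B (i, y)) (\<lambda>i. B (i, x))"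
  have T: "?T = {x \<in> A. card {y \<in> A. \<not> ?R y x} \<le> 2 ^ h}"
    by (simp add: candidates_def A_def)
  have "\<exists>m\<in>?T. \<forall>x\<in>?T. x \<noteq> m \<longrightarrow> \<not> ?R x m"
    using lexless_irrefl lexless_trans
    by (intro Finite_Set.bex_min_element[OF finite_candidates] False)
      (auto simp: asymp_on_def transp_on_def intro: lexless_trans, blast)
  then obtain m where m: "m \<in> ?T" "\<forall>x\<in>?T. \<not> ?R x m" using lexless_irrefl by metis
  have "?T \<subseteq> {y \<in> A. \<not> ?R y m}" using m T by auto
  then have "card ?T \<le> card {y \<in> A. \<not> ?R y m}"
    by (rule card_mono[rotated]) (simp add: A_def)
  also have "\<dots> \<le> 2 ^ h" using m T by auto
  finally show ?thesis .
qed simp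

lemma bounded_alg_match:
  assumes F: "set F \<subseteq> {..<n}" and K: "length F + 2 \<le> K" and xy: "x < n" "y < n"
  shows "bounded_alg (match_alg d b F l x y) (cmp_queries n d) {..<n}
    (50 * b * d * K ^ 2 + 50 * d * K ^ 2 * l)"
proof -
  have "bounded_alg (match_alg d b F l x y) (cmp_queries n d) {..<n}
      (50 * (b + l) * d * length (x # y # F) ^ 2 + 0)"
    unfolding match_alg_def
    by (rule bounded_alg_bind[OF bounded_alg_learn]) (use assms in auto)
  moreover have "50 * (b + l) * d * length (x # y # F) ^ 2 + 0 \<le> 50 * (b + l) * d * K ^ 2"
    using K by (simp add: power_mono)
  ultimately show ?thesis
    by (rule bounded_alg_mono[OF _ subset_refl order_trans]) (simp add: algebra_simps)
qed

lemma bounded_alg_sky_loop: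
  assumes "set F \<subseteq> {..<n}" "length F + k < K"
  shows "bounded_alg (sky_loop n d b h B k F) (cmp_queries n d) {r. \<forall>S. r = Some S \<longrightarrow> S \<subseteq> {..<n}}
     (k * (100 * d * K ^ 2 * (b + 2) * 2 ^ h))"
  using assms
proof (induction k arbitrary: F)
  case (Suc k)
  let ?R = "{r. \<forall>S. r = Some S \<longrightarrow> S \<subseteq> {..<n}}"
  let ?c = "100 * d * K ^ 2 * (b + 2) * 2 ^ h"
  let ?xs = "sorted_list_of_set (candidates n d h B F)"
  show ?case
  proof (cases "?xs = []")
    case True
    then show ?thesis using Suc.prems by simp
  next
    case False
    have t: "bounded_alg (tournament (match_alg d b F) h ?xs) (cmp_queries n d) {..<n}
        ((50 * b * d * K ^ 2 + 2 * (50 * d * K ^ 2)) * 2 ^ h)"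
      by (rule bounded_alg_tournament[OF bounded_alg_match])
        (use Suc.prems False candidates_subset finite_candidates in auto)
    have l: "bounded_alg (learn d b (w # F)) (cmp_queries n d) UNIV (50 * b * d * K ^ 2)"
      if "w < n" for w
    proof (rule bounded_alg_mono[OF bounded_alg_learn])
      show "50 * b * d * length (w # F) ^ 2 \<le> 50 * b * d * K ^ 2"
        using Suc.prems by (simp add: power_mono)
    qed (use that Suc.prems in auto)
    have "50 * b * d * K ^ 2 * 1 \<le> 50 * (b + 2) * d * K ^ 2 * 2 ^ h"
      by (intro mult_mono) auto
    then have sum: "(50 * b * d * K ^ 2 + 2 * (50 * d * K ^ 2)) * 2 ^ h + (50 * b * d * K ^ 2 + k * ?c)
        \<le> Suc k * ?c"
      by (simp add: algebra_simps)
    have "bounded_alg (bind_alg (tournament (match_alg d b F) h ?xs) (\<lambda>w.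
       bind_alg (learn d b (w # F)) (\<lambda>g.
         if covered d g F w then Return (Some (set F)) else sky_loop n d b h B k (w # F))))
       (cmp_queries n d) ?R (Suc k * ?c)"
    proof (rule bounded_alg_bind'[OF t bounded_alg_bind[OF l] sum])
      fix w g assume w: "w \<in> {..<n}"
      have "bounded_alg (sky_loop n d b h B k (w # F)) (cmp_queries n d) ?R (k * ?c)"
        by (rule Suc.IH) (use w Suc.prems in auto)
      then show "bounded_alg (if covered d g F w then Return (Some (set F)) else sky_loop n d b h B k (w # F))
         (cmp_queries n d) ?R (k * ?c)"
        using Suc.prems by auto
    qed simp
    then show ?thesis using False by (simp add: Let_def)
  qed
qed simp

section \<open>The error-free run, and how noisy ranks follow it\<close>

lemma ex_largest_subset:
  fixes key :: "'a \<Rightarrow> real"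
  assumes "finite Y" "m \<le> card Y"
  shows "\<exists>H\<subseteq>Y. card H = m \<and> (\<forall>h\<in>H. \<forall>y\<in>Y - H. key y \<le> key h)"
  using assms(2)
proof (induction m)
  case 0
  show ?case by (intro exI[of _ "{}"]) auto
next
  case (Suc m)
  then obtain H where H: "H \<subseteq> Y" "card H = m" "\<forall>h\<in>H. \<forall>y\<in>Y - H. key y \<le> key h" by auto
  have fin: "finite (key ` (Y - H))" using assms(1) by simp
  have "H \<noteq> Y" using H(2) Suc.prems by auto
  then have ne: "key ` (Y - H) \<noteq> {}" using H(1) by auto
  obtain z where z: "z \<in> Y - H" "Max (key ` (Y - H)) = key z"
    using Max_in[OF fin ne] by auto
  then have "key y \<le> key z" if "y \<in> Y - H" for y
    using Max_ge[OF fin, of "key y"] that by auto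
  moreover have "card (insert z H) = Suc m"
    using z H finite_subset[OF H(1) assms(1)] by simp
  ultimately show ?case using H z by (intro exI[of _ "insert z H"]) auto
qed

context noisy_points
begin

text \<open>The points up to \<open>s\<close> that correct ranks cannot tell from \<open>s\<close>
  in coordinate \<open>i\<close>. If the rank of \<open>s\<close> is odd, equality is certain and
  the set is empty.\<close>

definition crowd :: "nat list \<Rightarrow> nat \<Rightarrow> nat \<Rightarrow> nat set" where
  "crowd ps i s = {x. x < n \<and> pt x i \<le> pt s i \<and> true_rank ps i x = true_rank ps i s
     \<and> even (true_rank ps i s)}"

lemma finite_coord_vals: "finite (coord_vals pt i (set ps))"
  by (simp add: coord_vals_def)

text \<open>A pivot among the \<open>m\<close> largest values up to that of \<open>s\<close> splits off all smaller ones.\<close>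

lemma fails_le_crowd:
  assumes "0 < n"
  shows "fails_le (draw n k) Q (\<lambda>ps. card (crowd ps i s) \<le> m) (max 0 (1 - real m / real n) ^ k)"
proof -
  let ?Y = "{x. x < n \<and> pt x i \<le> pt s i}"
  have sub: "crowd ps i s \<subseteq> ?Y" for ps by (auto simp: crowd_def)
  show ?thesis
  proof (cases "m \<le> card ?Y")
    case False
    then have "card (crowd ps i s) \<le> m" for ps
      using card_mono[OF _ sub, of ps] by simp
    then show ?thesis by (simp add: fails_le_def ewp_const)
  next
    case True
    then obtain H where H: "H \<subseteq> ?Y" "card H = m"
      and top: "\<forall>h\<in>H. \<forall>y\<in>?Y - H. pt y i \<le> pt h i"
      using ex_largest_subset[of ?Y m "\<lambda>x. pt x i"] by auto
    have "crowd ps i s \<subseteq> H" if "set ps \<inter> H \<noteq> {}" for ps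
    proof
      fix x assume x: "x \<in> crowd ps i s"
      from that obtain r where r: "r \<in> set ps" "r \<in> H" by auto
      let ?V = "coord_vals pt i (set ps)"
      have rV: "pt r i \<in> ?V" using r by (simp add: coord_vals_def)
      show "x \<in> H"
      proof (rule ccontr)
        assume "x \<notin> H"
        then have xr: "pt x i \<le> pt r i" using top r x by (auto simp: crowd_def)
        have "pt r i \<le> pt s i" using H r by auto
        \<comment> \<open>The rank of \<open>s\<close> is even, so its value is not a pivot value
          and \<open>r\<close> lies strictly below it.\<close>
        moreover have "pt r i \<noteq> pt s i"
          using rV x odd_rank_iff[OF finite_coord_vals, of i ps "pt s i"] by (auto simp: crowd_def)
        ultimately have "pt r i < pt s i" by simp
        from rank_less_of_between[OF finite_coord_vals rV xr this] show False
          using x by (auto simp: crowd_def)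
      qed
    qed
    then have "card (crowd ps i s) \<le> m" if "set ps \<inter> H \<noteq> {}" for ps
      using that H card_mono[of H "crowd ps i s"] finite_subset[OF H(1)] by auto
    moreover have "H \<subseteq> {..<n}" using H by auto
    moreover have "card H \<le> n" using card_mono[of "{..<n}" H] H by auto
    ultimately show ?thesis
      using fails_le_draw[OF assms, of H k Q] H assms
      by (intro fails_le_mono[OF fails_le_draw[OF assms, of H k Q]]) auto
  qed
qed

definition uncovered :: "nat list \<Rightarrow> nat set" where
  "uncovered F = {x. x < n \<and> \<not> covered d truth F x}"

definition next_point :: "nat list \<Rightarrow> nat" where
  "next_point F = (SOME x. x \<in> uncovered F \<and>
     (\<forall>y\<in>uncovered F. y \<noteq> x \<longrightarrow> lexless d (pt y) (pt x)))"

lemma next_point: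
  assumes "uncovered F \<noteq> {}"
  shows "next_point F \<in> uncovered F"
    and "y \<in> uncovered F \<Longrightarrow> y \<noteq> next_point F \<Longrightarrow> lexless d (pt y) (pt (next_point F))"
proof -
  have fin: "finite (uncovered F)" by (simp add: uncovered_def)
  have "\<exists>m\<in>uncovered F. \<forall>x\<in>uncovered F. x \<noteq> m \<longrightarrow> \<not> lexless d (pt m) (pt x)"
    using lexless_irrefl lexless_trans
    by (intro Finite_Set.bex_max_element[OF fin _ _ assms])
      (auto simp: asymp_on_def transp_on_def intro: lexless_trans, blast)
  then obtain m where m: "m \<in> uncovered F"
    "\<And>x. x \<in> uncovered F \<Longrightarrow> x \<noteq> m \<Longrightarrow> \<not> lexless d (pt m) (pt x)" by auto
  have "lexless d (pt x) (pt m)" if x: "x \<in> uncovered F" "x \<noteq> m" for x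
  proof -
    have "\<exists>i<d. pt x i \<noteq> pt m i"
      using separated[of x m] x m(1) by (auto simp: uncovered_def)
    then show ?thesis using lexless_total[of _ d "pt x" "pt m"] m(2)[OF x] by auto
  qed
  then have "\<exists>x. x \<in> uncovered F \<and> (\<forall>y\<in>uncovered F. y \<noteq> x \<longrightarrow> lexless d (pt y) (pt x))"
    using m(1) by auto
  from someI_ex[OF this] show "next_point F \<in> uncovered F"
    and "y \<in> uncovered F \<Longrightarrow> y \<noteq> next_point F \<Longrightarrow> lexless d (pt y) (pt (next_point F))"
    by (auto simp: next_point_def)
qed

text \<open>The outcome of an error-free run; failure of the noisy run can then be stated as
  deviation from a fixed value.\<close>

primrec target :: "nat \<Rightarrow> nat list \<Rightarrow> nat set option" where
  "target 0 F = None"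
| "target (Suc k) F = (if uncovered F = {} then Some (set F) else target k (next_point F # F))"

text \<open>The points that an error-free run finds are determined before any pivot is drawn, which
  justifies a union bound over just these points.\<close>

primrec picks :: "nat \<Rightarrow> nat list \<Rightarrow> nat list" where
  "picks 0 F = F"
| "picks (Suc k) F = (if uncovered F = {} then F else picks k (next_point F # F))"

lemma set_subset_picks: "set F \<subseteq> set (picks k F)"
  by (induction k arbitrary: F) (auto, metis list.set_intros(2) subsetD)

lemma length_picks: "length (picks k F) \<le> length F + k"
  by (induction k arbitrary: F) (auto, metis add_Suc_shift list.size(4) One_nat_def add.right_neutral add_Suc_right)

text \<open>The skyline in terms of labels. Distinct labels differ in some coordinate, so weak
  domination by another label is already strict.\<close>

definition sky :: "nat set" where
  "sky = {x. x < n \<and> \<not> (\<exists>y<n. y \<noteq> x \<and> (\<forall>i<d. pt x i \<le> pt y i))}"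

lemma covered_truth: "covered d truth F x \<longleftrightarrow> (\<exists>f\<in>set F. \<forall>i<d. pt x i \<le> pt f i)"
  by (auto simp: covered_def truth_def not_less)

text \<open>By transitivity, whatever dominates an uncovered point is uncovered too, and being at
  least as large in every coordinate it cannot be lexicographically smaller than the
  maximum.\<close>

lemma next_point_in_sky:
  assumes "uncovered F \<noteq> {}"
  shows "next_point F \<in> sky - set F"
proof -
  let ?x = "next_point F"
  note x = next_point[OF assms]
  have "False" if y: "y < n" "y \<noteq> ?x" "\<forall>i<d. pt ?x i \<le> pt y i" for y
  proof -
    have "y \<in> uncovered F"
      using x(1) y unfolding uncovered_def covered_truth by (auto, meson order_trans)
    then have "lexless d (pt y) (pt ?x)" using x(2) y by auto
    then show False using y by (auto simp: lexless_def not_less[symmetric])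
  qed
  moreover have "?x < n" "?x \<notin> set F"
    using x(1) unfolding uncovered_def covered_truth by auto
  ultimately show ?thesis by (auto simp: sky_def)
qed

lemma uncovered_empty_imp:
  assumes "set F \<subseteq> sky" "uncovered F = {}"
  shows "set F = sky"
proof
  show "sky \<subseteq> set F"
  proof
    fix x assume x: "x \<in> sky"
    then have "covered d truth F x" using assms(2) by (auto simp: uncovered_def sky_def)
    then obtain f where "f \<in> set F" "\<forall>i<d. pt x i \<le> pt f i" unfolding covered_truth by auto
    then show "x \<in> set F" using x assms(1) by (auto simp: sky_def)
  qed
qed fact

text \<open>The absence of a condition on \<open>k\<close> matters: too small a guess leads to
  \<open>None\<close>, never to a wrong set.\<close>

lemma target_sound:
  "set F \<subseteq> sky \<Longrightarrow> target k F = Some S \<Longrightarrow> S = sky"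
proof (induction k arbitrary: F)
  case (Suc k)
  show ?case
  proof (cases "uncovered F = {}")
    case True
    then show ?thesis using Suc.prems uncovered_empty_imp by auto
  next
    case False
    then show ?thesis using Suc.IH[of "next_point F # F"] Suc.prems next_point_in_sky[OF False] by auto
  qed
qed simp

lemma target_complete:
  "set F \<subseteq> sky \<Longrightarrow> distinct F \<Longrightarrow> card sky < length F + k \<Longrightarrow> target k F = Some sky"
proof (induction k arbitrary: F)
  case 0
  have "finite sky" by (simp add: sky_def)
  then have "card (set F) \<le> card sky" using 0 by (intro card_mono) auto
  then show ?case using 0 by (simp add: distinct_card)
next
  case (Suc k)
  show ?case
  proof (cases "uncovered F = {}")
    case True
    then show ?thesis using Suc.prems uncovered_empty_imp by auto
  next
    case False
    then show ?thesis using Suc.IH[of "next_point F # F"] Suc.prems next_point_in_sky[OF False] by auto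
  qed
qed

text \<open>With a correct table the wanted point beats every other point: a covered opponent loses
  outright, and an uncovered one is lexicographically smaller.\<close>

lemma fails_le_match:
  assumes F: "set F \<subseteq> {..<n}" "length F + 2 \<le> K" and xy: "x < n" "y < n"
    and ne: "uncovered F \<noteq> {}" and q: "x = next_point F \<or> y = next_point F"
  shows "fails_le (match_alg d b F l x y) Q (\<lambda>r. r = next_point F) (real (d * K ^ 2) / 2 ^ b / 2 ^ l)"
  unfolding match_alg_def
proof (rule fails_le_bind)
  let ?Y = "x # y # F"
  show "fails_le (learn d (b + l) ?Y) Q
     (\<lambda>g. \<forall>i<d. \<forall>x\<in>set ?Y. \<forall>y\<in>set ?Y. g (i, x, y) = truth (i, x, y)) (real (d * K ^ 2) / 2 ^ (b + l))"
    by (rule fails_le_learn) (use F xy in auto)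
  show "real (d * K ^ 2) / 2 ^ (b + l) + 0 \<le> real (d * K ^ 2) / 2 ^ b / 2 ^ l"
    by (simp add: power_add)
  fix g assume g: "\<forall>i<d. \<forall>x\<in>set ?Y. \<forall>y\<in>set ?Y. g (i, x, y) = truth (i, x, y)"
  have covered: "covered d g F z \<longleftrightarrow> covered d truth F z" if "z \<in> {x, y}" for z
  proof -
    have "g (i, f, z) = truth (i, f, z)" if "i < d" "f \<in> set F" for i f
      using g that \<open>z \<in> {x, y}\<close> by auto
    then show ?thesis unfolding covered_def by blast
  qed
  have lex: "table_lexless d g x y \<longleftrightarrow> lexless d (pt x) (pt y)"
  proof -
    have "(g (i, x, y) \<longleftrightarrow> pt x i < pt y i) \<and> (\<not> g (i, x, y) \<and> \<not> g (i, y, x) \<longleftrightarrow> pt x i = pt y i)"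
      if "i < d" for i using g that by (auto simp: truth_def)
    then have eqs: "\<And>i. i < d \<Longrightarrow> g (i, x, y) \<longleftrightarrow> pt x i < pt y i"
      "\<And>i. i < d \<Longrightarrow> \<not> g (i, x, y) \<and> \<not> g (i, y, x) \<longleftrightarrow> pt x i = pt y i" by auto
    have "g (i, x, y) \<and> (\<forall>j<i. \<not> g (j, x, y) \<and> \<not> g (j, y, x))
        \<longleftrightarrow> pt x i < pt y i \<and> (\<forall>j<i. pt x j = pt y j)" if "i < d" for i
      using eqs that order.strict_trans by blast
    then show ?thesis unfolding table_lexless_def lexless_def by blast
  qed
  note np = next_point[OF ne]
  have unc: "z \<in> uncovered F" if "z \<in> {x, y}" "\<not> covered d truth F z" for z
    using that xy by (auto simp: uncovered_def)
  have npc: "\<not> covered d truth F (next_point F)" using np(1) by (simp add: uncovered_def)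
  have "(if covered d g F x then y else if covered d g F y then x
      else if table_lexless d g x y then y else x) = next_point F"
  proof (cases "x = next_point F")
    case True
    have "y = x" if "\<not> covered d truth F y" "lexless d (pt x) (pt y)"
    proof (rule ccontr)
      assume "y \<noteq> x"
      then have "lexless d (pt y) (pt x)" using np(2)[of y] unc[of y] that True by auto
      then show False using that(2) lexless_trans lexless_irrefl by blast
    qed
    then show ?thesis using True npc covered lex by auto
  next
    case False
    then have y: "y = next_point F" using q by auto
    have "lexless d (pt x) (pt y)" if "\<not> covered d truth F x"
      using np(2)[of x] unc[of x] that y False by auto
    then show ?thesis using y npc covered lex by auto
  qed
  then show "fails_le (Return (if covered d g F x then y else if covered d g F y then x
      else if table_lexless d g x y then y else x)) Q (\<lambda>r. r = next_point F) 0"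
    by (intro fails_le_Return) auto
qed simp

definition good_ranks :: "nat list \<Rightarrow> nat set \<Rightarrow> nat \<Rightarrow> (nat \<times> nat \<Rightarrow> nat) \<Rightarrow> bool" where
  "good_ranks ps S0 c B \<longleftrightarrow> (\<forall>s\<in>S0. \<forall>i<d. B (i, s) = true_rank ps i s) \<and>
     card {x. x < n \<and> (\<exists>i<d. B (i, x) \<noteq> true_rank ps i x)} \<le> c"

text \<open>Let \<open>y\<close> be a correctly placed survivor other than the wanted point and not
  below it in the ranks. Then \<open>y\<close> shares a gap with a point of \<open>S0\<close>: with
  the wanted point if \<open>y\<close> is uncovered, and with a point of \<open>F\<close> if
  \<open>y\<close> is covered but not eliminated. Adding up misplaced points, crowds and the wanted
  point gives the left side of \<open>h\<close>.\<close>

lemma next_point_candidate: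
  assumes good: "good_ranks ps S0 c B" and S0: "finite S0" "S0 \<subseteq> {..<n}"
    and crowd: "\<And>s i. s \<in> S0 \<Longrightarrow> i < d \<Longrightarrow> card (crowd ps i s) \<le> m"
    and h: "c + card S0 * d * m + 1 \<le> 2 ^ h"
    and F: "set F \<subseteq> S0" and ne: "uncovered F \<noteq> {}" and q: "next_point F \<in> S0"
  shows "next_point F \<in> candidates n d h B F"
proof -
  let ?q = "next_point F"
  let ?r = "true_rank ps"
  define A where "A = {x. x < n \<and> \<not> eliminated d B F x}"
  note np = next_point[OF ne]
  have B: "B (i, s) = ?r i s" if "s \<in> S0" "i < d" for s i
    using good that by (auto simp: good_ranks_def)
  have elim_le: "u \<le> v" if "rank_in V u < rank_in V v \<or> rank_in V u = rank_in V v \<and> odd (rank_in V v)" "finite V"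
    for V and u v :: real
    using that rank_less_imp[of V u v] rank_eq_odd[of V u v] by auto
  have qA: "?q \<in> A"
  proof -
    have "\<not> eliminated d B F ?q"
    proof
      assume "eliminated d B F ?q"
      then obtain f where f: "f \<in> set F"
        "\<forall>i<d. B (i, ?q) < B (i, f) \<or> B (i, ?q) = B (i, f) \<and> odd (B (i, f))"
        by (auto simp: eliminated_def)
      have "pt ?q i \<le> pt f i" if "i < d" for i
        using elim_le[OF _ finite_coord_vals] f that B[OF q that] B[OF subsetD[OF F f(1)] that] by metis
      then show False using np(1) f(1) by (auto simp: uncovered_def covered_truth)
    qed
    then show ?thesis using np(1) by (auto simp: A_def uncovered_def)
  qed
  let ?bad = "{x. x < n \<and> (\<exists>i<d. B (i, x) \<noteq> ?r i x)}"
  let ?crowds = "\<Union>s\<in>S0. \<Union>i\<in>{..<d}. crowd ps i s"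
  have sub: "{y \<in> A. \<not> lexless d (\<lambda>i. B (i, y)) (\<lambda>i. B (i, ?q))} \<subseteq> insert ?q (?bad \<union> ?crowds)"
  proof
    fix y assume y: "y \<in> {y \<in> A. \<not> lexless d (\<lambda>i. B (i, y)) (\<lambda>i. B (i, ?q))}"
    then have yn: "y < n" and nel: "\<not> eliminated d B F y"
      and nlex: "\<not> lexless d (\<lambda>i. B (i, y)) (\<lambda>i. B (i, ?q))" by (auto simp: A_def)
    show "y \<in> insert ?q (?bad \<union> ?crowds)"
    proof (cases "y \<in> ?bad \<or> y = ?q")
      case False
      then have By: "B (i, y) = ?r i y" if "i < d" for i using that yn by auto
      have "\<exists>s\<in>S0. \<exists>i<d. y \<in> crowd ps i s"
      proof (cases "y \<in> uncovered F")
        case True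
        then have "lexless d (pt y) (pt ?q)" using np(2) False by auto
        then obtain i where i: "i < d" "pt y i < pt ?q i" "\<forall>j<i. pt y j = pt ?q j"
          by (auto simp: lexless_def)
        have le: "?r i y \<le> ?r i ?q" using i finite_coord_vals by (intro rank_mono) auto
        \<comment> \<open>Before coordinate \<open>i\<close> the values agree and hence the ranks
          do, so a smaller rank at \<open>i\<close> would put \<open>y\<close> lexicographically
          below.\<close>
        have "\<not> ?r i y < ?r i ?q"
        proof
          assume "?r i y < ?r i ?q"
          then have "lexless d (\<lambda>i. B (i, y)) (\<lambda>i. B (i, ?q))"
            using i By B[OF q] unfolding lexless_def by (intro exI[of _ i]) auto
          then show False using nlex by simp
        qed
        then have eq: "?r i y = ?r i ?q" using le by simp
        have "even (?r i ?q)" using rank_eq_odd[OF finite_coord_vals eq] i by auto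
        then have "y \<in> crowd ps i ?q" using i eq yn by (auto simp: crowd_def)
        then show ?thesis using q i by blast
      next
        case False
        then obtain f where f: "f \<in> set F" "\<forall>i<d. pt y i \<le> pt f i"
          using yn by (auto simp: uncovered_def covered_truth)
        then obtain i where i: "i < d" "\<not> (B (i, y) < B (i, f) \<or> B (i, y) = B (i, f) \<and> odd (B (i, f)))"
          using nel by (auto simp: eliminated_def)
        have fS: "f \<in> S0" using f F by auto
        have "?r i y \<le> ?r i f" using f i finite_coord_vals by (intro rank_mono) auto
        then have "y \<in> crowd ps i f"
          using i f yn By[OF i(1)] B[OF fS i(1)] by (auto simp: crowd_def)
        then show ?thesis using fS i by blast
      qed
      then show ?thesis by auto
    qed auto
  qed
  have fin: "finite ?crowds" using S0 by (auto simp: crowd_def)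
  have "card ?crowds \<le> (\<Sum>s\<in>S0. card (\<Union>i\<in>{..<d}. crowd ps i s))"
    by (rule card_UN_le[OF S0(1)])
  also have "\<dots> \<le> (\<Sum>s\<in>S0. d * m)"
  proof (rule sum_mono)
    fix s assume s: "s \<in> S0"
    have "card (\<Union>i\<in>{..<d}. crowd ps i s) \<le> (\<Sum>i\<in>{..<d}. card (crowd ps i s))"
      by (rule card_UN_le) simp
    also have "\<dots> \<le> (\<Sum>i\<in>{..<d}. m)" by (rule sum_mono) (use crowd s in auto)
    finally show "card (\<Union>i\<in>{..<d}. crowd ps i s) \<le> d * m" by simp
  qed
  finally have crowds: "card ?crowds \<le> card S0 * d * m" by simp
  have "card {y \<in> A. \<not> lexless d (\<lambda>i. B (i, y)) (\<lambda>i. B (i, ?q))} \<le> card (insert ?q (?bad \<union> ?crowds))"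
    by (rule card_mono[OF _ sub]) (use fin in auto)
  also have "\<dots> \<le> Suc (card (?bad \<union> ?crowds))" by (rule card_insert_le_m1) auto
  also have "card (?bad \<union> ?crowds) \<le> card ?bad + card ?crowds" by (rule card_Un_le)
  also have "card ?bad \<le> c" using good by (simp add: good_ranks_def)
  finally have "card {y \<in> A. \<not> lexless d (\<lambda>i. B (i, y)) (\<lambda>i. B (i, ?q))} \<le> 2 ^ h"
    using crowds h by simp
  then show ?thesis using qA by (simp add: candidates_def A_def)
qed

text \<open>Each round contributes two equal error terms, one for the tournament and one for the
  check of its winner.\<close>

lemma fails_le_sky_loop:
  assumes good: "good_ranks ps S0 c B" and S0: "finite S0" "S0 \<subseteq> {..<n}"
    and crowd: "\<And>s i. s \<in> S0 \<Longrightarrow> i < d \<Longrightarrow> card (crowd ps i s) \<le> m"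
    and h: "c + card S0 * d * m + 1 \<le> 2 ^ h"
    and F: "set (picks k F) \<subseteq> S0" and K: "length F + k < K"
  shows "fails_le (sky_loop n d b h B k F) Q (\<lambda>r. r = target k F)
     (real k * (2 * (real (d * K ^ 2) / 2 ^ b)))"
  using F K
proof (induction k arbitrary: F)
  case 0
  then show ?case by (simp add: fails_le_Return)
next
  case (Suc k)
  let ?e = "real (d * K ^ 2) / 2 ^ b"
  let ?xs = "sorted_list_of_set (candidates n d h B F)"
  have FS: "set F \<subseteq> S0" using Suc.prems(1) set_subset_picks[of F "Suc k"] by auto
  then have Fn: "set F \<subseteq> {..<n}" using S0 by auto
  have set_xs: "set ?xs = candidates n d h B F" using finite_candidates by simp
  have match: "bounded_alg (match_alg d b F l x y) (cmp_queries n d) {..<n}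
      (50 * b * d * K ^ 2 + 50 * d * K ^ 2 * l)" if "x \<in> {..<n}" "y \<in> {..<n}" for l x y
    by (rule bounded_alg_match) (use Fn Suc.prems that in auto)
  have check: "fails_le (learn d b (w # F)) Q
      (\<lambda>g. covered d g F w \<longleftrightarrow> covered d truth F w) ?e" if "w < n" for w
    by (rule fails_le_mono[OF fails_le_learn[where k = K]])
      (use that Fn Suc.prems in \<open>auto simp: covered_def\<close>)
  have outs: "outputs (tournament (match_alg d b F) h ?xs) \<subseteq> {..<n}" if "?xs \<noteq> []"
    by (rule bounded_alg_outputs[OF bounded_alg_tournament[OF match that]])
      (auto simp: set_xs dest: subsetD[OF candidates_subset])
  show ?case
  proof (cases "?xs = []")
    case True
    then have "candidates n d h B F = {}" using set_xs by simp
    \<comment> \<open>With good ranks the wanted point is always a candidate, so an empty candidate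
      list proves that nothing is left.\<close>
    then have "uncovered F = {}"
      using next_point_candidate[OF good S0 crowd h FS] Suc.prems(1)
        set_subset_picks[of "next_point F # F" k] by (cases "uncovered F = {}") auto
    then show ?thesis using True by (simp add: fails_le_Return)
  next
    case ne: False
    let ?rest = "\<lambda>w. bind_alg (learn d b (w # F)) (\<lambda>g.
         if covered d g F w then Return (Some (set F)) else sky_loop n d b h B k (w # F))"
    have "fails_le (bind_alg (tournament (match_alg d b F) h ?xs) ?rest) Q (\<lambda>r. r = target (Suc k) F)
       (real (Suc k) * (2 * ?e))"
    proof (cases "uncovered F = {}")
      case True
      \<comment> \<open>Whoever wins here is covered, so only the check can fail.\<close>
      have "fails_le (tournament (match_alg d b F) h ?xs) Q (\<lambda>_. True) 0"
        by (simp add: fails_le_def ewp_const)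
      then show ?thesis
      proof (rule fails_le_bind)
        fix w assume "w \<in> outputs (tournament (match_alg d b F) h ?xs)"
        then have w: "w < n" using outs[OF ne] by auto
        then have cov: "covered d truth F w" using True by (auto simp: uncovered_def)
        show "fails_le (?rest w) Q (\<lambda>r. r = target (Suc k) F) ?e"
          by (rule fails_le_bind[OF check[OF w], where e' = 0])
            (use cov True in \<open>auto intro!: fails_le_Return\<close>)
      next
        show "0 + ?e \<le> real (Suc k) * (2 * ?e)"
          by (simp add: field_simps)
      qed simp
    next
      case False
      let ?q = "next_point F"
      have tr: "set (picks k (?q # F)) \<subseteq> S0" using Suc.prems(1) False by simp
      then have qS: "?q \<in> S0" using set_subset_picks[of "?q # F" k] by auto
      have "fails_le (tournament (match_alg d b F) h ?xs) Q (\<lambda>r. r = ?q) (?e * (1 - 1 / 2 ^ h))"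
      proof (rule fails_le_tournament[OF match])
        show "fails_le (match_alg d b F l x y) Q (\<lambda>r. r = ?q) (?e / 2 ^ l)"
          if "x \<in> {..<n}" "y \<in> {..<n}" "x = ?q \<or> y = ?q" for l x y
          by (rule fails_le_match) (use that Fn Suc.prems False in auto)
        show "?q \<in> set ?xs" unfolding set_xs
          by (rule next_point_candidate[OF good S0 crowd h FS False qS])
        show "set ?xs \<subseteq> {..<n}" unfolding set_xs by (rule candidates_subset)
        show "length ?xs \<le> 2 ^ h" using card_candidates by simp
      qed simp_all
      then show ?thesis
      proof (rule fails_le_bind)
        fix w assume w: "w = ?q"
        have qn: "w < n" "\<not> covered d truth F w"
          using next_point[OF False] w by (auto simp: uncovered_def)
        show "fails_le (?rest w) Q (\<lambda>r. r = target (Suc k) F) (?e + real k * (2 * ?e))"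
        proof (rule fails_le_bind[OF check[OF qn(1)]])
          fix g assume "covered d g F w \<longleftrightarrow> covered d truth F w"
          moreover have "fails_le (sky_loop n d b h B k (w # F)) Q (\<lambda>r. r = target (Suc k) F) (real k * (2 * ?e))"
            using Suc.IH[of "?q # F"] tr Suc.prems(2) False w by simp
          ultimately show "fails_le (if covered d g F w then Return (Some (set F))
              else sky_loop n d b h B k (w # F)) Q (\<lambda>r. r = target (Suc k) F) (real k * (2 * ?e))"
            using qn by simp
        qed simp_all
      next
        have "x + (e + real k * (2 * e)) \<le> real (Suc k) * (2 * e)" if "x \<le> e * 1" for x e :: real
          using that by (simp add: algebra_simps)
        then show "?e * (1 - 1 / 2 ^ h) + (?e + real k * (2 * ?e)) \<le> real (Suc k) * (2 * ?e)"
          by this (intro mult_left_mono, auto)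
      qed simp
    qed
    then show ?thesis using ne by (simp add: Let_def)
  qed
qed

end

section \<open>Guessing the size of the skyline\<close>

definition attempt :: "nat \<Rightarrow> nat \<Rightarrow> nat \<Rightarrow> (cmp_query, nat set option) query_alg" where
  "attempt n d l = bind_alg (draw n (2 ^ (10 * l))) (\<lambda>ps. bind_alg (prepare n d (30 * l) ps)
     (\<lambda>B. sky_loop n d (30 * l) (floor_log n - 3 * l) B (2 ^ l) []))"

definition sort_all :: "nat \<Rightarrow> nat \<Rightarrow> nat \<Rightarrow> (cmp_query, nat set) query_alg" where
  "sort_all n d l = bind_alg (prepare n d (30 * l) [0..<n]) (\<lambda>B.
     Return {x. x < n \<and> \<not> (\<exists>y<n. y \<noteq> x \<and> (\<forall>i<d. B (i, x) \<le> B (i, y)))})"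

text \<open>Doubling \<open>l\<close> squares K. The test \<open>l = 0\<close> is there for
  termination, since doubling 0 makes no progress.\<close>

function stages :: "nat \<Rightarrow> nat \<Rightarrow> nat \<Rightarrow> (cmp_query, nat set) query_alg" where
  "stages n d l = (if l = 0 \<or> n < 2 ^ (10 * l) then sort_all n d l
     else bind_alg (attempt n d l)
       (\<lambda>r. case r of Some S \<Rightarrow> Return S | None \<Rightarrow> stages n d (2 * l)))"
  by auto
termination
proof (relation "Wellfounded.measure (\<lambda>(n, d, l). n - l)")
  fix n d l :: nat and r :: "nat set option"
  assume "\<not> (l = 0 \<or> n < 2 ^ (10 * l))"
  moreover have "l < 2 ^ l" by (rule less_exp)
  moreover have "(2::nat) ^ l \<le> 2 ^ (10 * l)" by (rule power_increasing) auto
  ultimately have "0 < l" "l < n" by linarith+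
  then show "((n, d, 2 * l), n, d, l) \<in> Wellfounded.measure (\<lambda>(n, d, l). n - l)" by auto
qed simp

declare stages.simps [simp del]

lemma floor_log_attempt:
  assumes "0 < l" "2 ^ (10 * l) \<le> n"
  shows "10 * l \<le> floor_log n"
  using floor_log_le_iff[of "2 ^ (10 * l)" n] assms by (simp add: monoD[OF floor_log_mono])

lemma bounded_alg_attempt:
  assumes l: "0 < l" and n: "2 ^ (10 * l) \<le> n"
  shows "bounded_alg (attempt n d l) (cmp_queries n d) {r. \<forall>S. r = Some S \<longrightarrow> S \<subseteq> {..<n}}
    (16000 * n * d * l)"
proof -
  define h where "h = floor_log n - 3 * l"
  have "0 < n" using n by (cases n) auto
  have "2 ^ h * 2 ^ (3 * l) = (2::nat) ^ floor_log n"
    using floor_log_attempt[OF assms] by (simp add: h_def flip: power_add)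
  then have h: "2 ^ h * (2 ^ l) ^ 3 \<le> n"
    using floor_log_exp2_le[OF \<open>0 < n\<close>] by (simp add: power_mult mult.commute)
  define K :: nat where "K = 2 ^ l"
  have K: "1 \<le> K" by (simp add: K_def)
  have "(K + 1) ^ 2 \<le> (2 * K) ^ 2" using K by (intro power_mono) auto
  then have K1: "(K + 1) ^ 2 \<le> 4 * K ^ 2" by (simp add: power_mult_distrib)
  have "K * (100 * d * (K + 1) ^ 2 * (30 * l + 2) * 2 ^ h)
      \<le> K * (100 * d * (4 * K ^ 2) * (32 * l) * 2 ^ h)"
    using K1 l by (intro mult_mono le_refl) auto
  also have "\<dots> = 12800 * d * l * (2 ^ h * K ^ 3)" by (simp add: power2_eq_square power3_eq_cube)
  also have "\<dots> \<le> 12800 * d * l * n" using h unfolding K_def by (intro mult_left_mono) auto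
  \<comment> \<open>The \<open>3 * l\<close> in \<open>h\<close> pays off here: the factor K^3 from
    K rounds with quadratic tables is absorbed by \<open>2 ^ h\<close>. Preparation contributes 3000
    and the rounds 12800 to the constant.\<close>
  finally have cost: "0 + (100 * n * d * (30 * l) + K * (100 * d * (K + 1) ^ 2 * (30 * l + 2) * 2 ^ h))
      \<le> 16000 * n * d * l" by (simp add: algebra_simps)
  show ?thesis
    unfolding attempt_def h_def[symmetric]
  proof (rule bounded_alg_bind'[OF bounded_alg_draw[OF \<open>0 < n\<close>] bounded_alg_bind[OF bounded_alg_prepare] cost])
    show "bounded_alg (sky_loop n d (30 * l) h B (2 ^ l) []) (cmp_queries n d)
        {r. \<forall>S. r = Some S \<longrightarrow> S \<subseteq> {..<n}} (K * (100 * d * (K + 1) ^ 2 * (30 * l + 2) * 2 ^ h))" for B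
      unfolding K_def by (rule bounded_alg_sky_loop) auto
  qed (use n in auto)
qed

lemma bounded_alg_sort_all:
  "bounded_alg (sort_all n d l) (cmp_queries n d) (Pow {..<n}) (16000 * n * d * l)"
proof -
  have "bounded_alg (sort_all n d l) (cmp_queries n d) (Pow {..<n}) (100 * n * d * (30 * l) + 0)"
    unfolding sort_all_def by (rule bounded_alg_bind[OF bounded_alg_prepare]) auto
  then show ?thesis by (rule bounded_alg_mono) auto
qed

lemma bounded_alg_stages:
  "\<exists>c. bounded_alg (stages n d l) (cmp_queries n d) (Pow {..<n}) c"
proof (induction n d l rule: stages.induct)
  case (1 n d l)
  show ?case
  proof (cases "l = 0 \<or> n < 2 ^ (10 * l)")
    case True
    then have "stages n d l = sort_all n d l" by (simp add: stages.simps)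
    then show ?thesis using bounded_alg_sort_all by auto
  next
    case False
    then obtain c where c: "bounded_alg (stages n d (2 * l)) (cmp_queries n d) (Pow {..<n}) c"
      using 1[OF False] by auto
    have "bounded_alg (case r of Some S \<Rightarrow> Return S | None \<Rightarrow> stages n d (2 * l))
        (cmp_queries n d) (Pow {..<n}) c" if "r \<in> {r. \<forall>S. r = Some S \<longrightarrow> S \<subseteq> {..<n}}" for r
      using that c by (cases r) auto
    then have "bounded_alg (bind_alg (attempt n d l)
        (\<lambda>r. case r of Some S \<Rightarrow> Return S | None \<Rightarrow> stages n d (2 * l)))
        (cmp_queries n d) (Pow {..<n}) (16000 * n * d * l + c)"
      by (intro bounded_alg_bind[OF bounded_alg_attempt]) (use False in auto)
    then show ?thesis using False by (auto simp: stages.simps[of n d l])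
  qed
qed

lemma const_over_power_le:
  fixes x :: real
  assumes "c \<le> x" "1 \<le> x" "2 \<le> k"
  shows "c / x ^ k \<le> 1 / x"
proof -
  have "c * x \<le> x * x" using assms by (intro mult_right_mono) auto
  also have "\<dots> = x ^ 2" by (simp add: power2_eq_square)
  also have "\<dots> \<le> x ^ k" using assms by (intro power_increasing) auto
  finally have "c \<le> x ^ k / x" using assms by (simp add: pos_le_divide_eq)
  then show ?thesis using assms by (simp add: divide_le_eq)
qed

lemma of_nat_add_cost:
  "(of_nat (t + 16000 * n * d * l) :: ennreal) = of_nat t + ennreal (16000 * real n * real d * real l)"
proof -
  have "(of_nat (t + 16000 * n * d * l) :: ennreal) = ennreal (real t + 16000 * real n * real d * real l)"
    unfolding ennreal_of_nat_eq_real_of_nat by simp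
  also have "\<dots> = ennreal (real t) + ennreal (16000 * real n * real d * real l)"
    by (rule ennreal_plus) auto
  finally show ?thesis by (simp only: ennreal_of_nat_eq_real_of_nat)
qed

text \<open>For p <= 1, (1 - p)(1 + p) <= 1 and Bernoulli's inequality give (1 - p)^s <= 1 / (1 +
  p)^s <= 1 / (s p). This polynomial decay suffices because there are as many as K^10
  pivots.\<close>

lemma miss_prob_le:
  fixes p :: real
  assumes "0 \<le> p"
  shows "max 0 (1 - p) ^ s * (real s * p) \<le> 1"
proof -
  have "max 0 (1 - p) * (1 + p) \<le> 1"
  proof (cases "p \<le> 1")
    case True
    have "(1 - p) * (1 + p) = 1 - p * p" by (simp add: algebra_simps)
    then show ?thesis using True by simp
  qed simp
  then have le: "(max 0 (1 - p) * (1 + p)) ^ s \<le> 1"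
    using assms by (intro power_le_one mult_nonneg_nonneg) auto
  have "real s * p \<le> (1 + p) ^ s"
    using Bernoulli_inequality[of p s] assms by (simp add: mult.commute)
  then have "max 0 (1 - p) ^ s * (real s * p) \<le> max 0 (1 - p) ^ s * (1 + p) ^ s"
    by (intro mult_left_mono) auto
  then show ?thesis using le by (simp add: power_mult_distrib)
qed

section \<open>Failure probability of the stages\<close>

context noisy_points
begin

lemma fails_le_sort_all:
  assumes n: "n < 2 ^ (10 * l)" and d: "d \<le> 2 ^ l" and l: "6 \<le> l"
  shows "fails_le (sort_all n d l) Q (\<lambda>S. S = sky) (1 / 2 ^ l)"
  unfolding sort_all_def
proof (rule fails_le_bind)
  let ?P = "\<lambda>B. \<forall>i<d. \<forall>x<n. B (i, x) = true_rank [0..<n] i x"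
  show "fails_le (prepare n d (30 * l) [0..<n]) Q ?P
     ((real n + (\<Sum>x<n. 1)) * real d * (real (2 * n) / 2 ^ (30 * l)))"
  proof (rule fails_le_prepare)
    fix B :: "nat \<times> nat \<Rightarrow> nat"
    let ?f = "\<lambda>(i, x). ennreal 1 * (if B (i, x) = true_rank [0..<n] i x then 0 else 1)"
    assume less: "(\<Sum>q\<in>{..<d} \<times> {..<n}. ?f q) < 1"
    show "?P B"
    proof (rule ccontr)
      assume "\<not> ?P B"
      then obtain i x where ix: "(i, x) \<in> {..<d} \<times> {..<n}" "B (i, x) \<noteq> true_rank [0..<n] i x" by auto
      have "?f (i, x) \<le> (\<Sum>q\<in>{..<d} \<times> {..<n}. ?f q)"
        by (rule member_le_sum[OF ix(1)]) auto
      then show False using less ix(2) by simp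
    qed
  qed auto
  let ?K = "(2::real) ^ l"
  have "(2::real) ^ 6 \<le> ?K" using l by (intro power_increasing) auto
  then have K: "64 \<le> ?K" by simp
  have dK: "real d \<le> ?K" using of_nat_mono[OF d, where 'a = real] by simp
  have nK: "real n \<le> ?K ^ 10"
    using of_nat_mono[OF less_imp_le[OF n], where 'a = real]
    by (simp add: power_mult[symmetric] mult.commute)
  have "(real n + (\<Sum>x<n. 1)) * real d * (real (2 * n) / 2 ^ (30 * l))
      = 4 * (real n * real n * real d) / ?K ^ 30"
    by (simp add: power_mult[symmetric] mult.commute field_simps)
  also have "\<dots> \<le> 4 * (?K ^ 10 * ?K ^ 10 * ?K) / ?K ^ 30"
    using nK dK by (intro divide_right_mono mult_left_mono mult_mono) auto
  also have "\<dots> = 4 / ?K ^ 9"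
    by (simp add: field_simps flip: power_add power_Suc)
  also have "\<dots> \<le> 1 / ?K"
    using K by (intro const_over_power_le) auto
  finally show "(real n + (\<Sum>x<n. 1)) * real d * (real (2 * n) / 2 ^ (30 * l)) + 0 \<le> 1 / 2 ^ l"
    by simp
  fix B assume B: "?P B"
  \<comment> \<open>Here every value is a pivot value and has an odd rank of its own, so the ranks
    reproduce the order exactly.\<close>
  have "B (i, x) \<le> B (i, y) \<longleftrightarrow> pt x i \<le> pt y i" if "i < d" "x < n" "y < n" for i x y
  proof
    assume "pt x i \<le> pt y i"
    then have "true_rank [0..<n] i x \<le> true_rank [0..<n] i y" by (rule rank_mono[OF finite_coord_vals])
    then show "B (i, x) \<le> B (i, y)" using B that by simp
  next
    assume le: "B (i, x) \<le> B (i, y)"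
    show "pt x i \<le> pt y i"
    proof (rule ccontr)
      assume "\<not> ?thesis"
      moreover have "pt y i \<in> coord_vals pt i (set [0..<n])" using that by (simp add: coord_vals_def)
      ultimately have "true_rank [0..<n] i y < true_rank [0..<n] i x"
        by (intro rank_less_of_between[where r = "pt y i"] finite_coord_vals) auto
      then show False using le B that by simp
    qed
  qed
  then have "{x. x < n \<and> \<not> (\<exists>y<n. y \<noteq> x \<and> (\<forall>i<d. B (i, x) \<le> B (i, y)))} = sky"
    unfolding sky_def by blast
  then show "fails_le (Return {x. x < n \<and> \<not> (\<exists>y<n. y \<noteq> x \<and> (\<forall>i<d. B (i, x) \<le> B (i, y)))}) Q
      (\<lambda>S. S = sky) 0"
    by (intro fails_le_Return) auto
qed simp

text \<open>Weight at least 1 on \<open>S0\<close> rules out any error there. The share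
  \<open>1 / Suc c\<close> of every point makes the weighted count reach 1 as soon as
  \<open>Suc c\<close> points are misplaced.\<close>

lemma fails_le_good_ranks:
  assumes ps: "set ps \<subseteq> {..<n}" "length ps \<le> s" and S0: "S0 \<subseteq> {..<n}"
  shows "fails_le (prepare n d b ps) Q (good_ranks ps S0 c)
     ((real s + (real (card S0) + real n / real (Suc c))) * real d * (real (2 * s) / 2 ^ b))"
proof -
  let ?w = "\<lambda>x. of_bool (x \<in> S0) + 1 / real (Suc c)"
  have "(\<Sum>x<n. ?w x) = real (card S0) + real n / real (Suc c)"
  proof -
    have "{..<n} \<inter> S0 = S0" using S0 by auto
    then show ?thesis by (simp add: sum.distrib of_bool_def sum.If_cases)
  qed
  moreover have "fails_le (prepare n d b ps) Q (good_ranks ps S0 c)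
     ((real s + (\<Sum>x<n. ?w x)) * real d * (real (2 * s) / 2 ^ b))"
  proof (rule fails_le_prepare[OF ps])
    fix B :: "nat \<times> nat \<Rightarrow> nat"
    let ?f = "\<lambda>(i, x). ennreal (?w x) * (if B (i, x) = true_rank ps i x then 0 else 1)"
    let ?I = "{..<d} \<times> {..<n}"
    assume less: "(\<Sum>q\<in>?I. ?f q) < 1"
    have "B (i, x) = true_rank ps i x" if "x \<in> S0" "i < d" for i x
    proof (rule ccontr)
      assume neq: "B (i, x) \<noteq> true_rank ps i x"
      have "?f (i, x) \<le> (\<Sum>q\<in>?I. ?f q)"
        by (rule member_le_sum) (use that S0 in auto)
      moreover have "ennreal 1 \<le> ennreal (?w x)" by (rule ennreal_leI) (use that in simp)
      then have "1 \<le> ?f (i, x)" using neq by simp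
      ultimately show False using less by simp
    qed
    moreover have "card {x. x < n \<and> (\<exists>i<d. B (i, x) \<noteq> true_rank ps i x)} \<le> c"
    proof (rule ccontr)
      let ?bad = "{x. x < n \<and> (\<exists>i<d. B (i, x) \<noteq> true_rank ps i x)}"
      assume "\<not> card ?bad \<le> c"
      then have many: "Suc c \<le> card ?bad" by simp
      \<comment> \<open>One wrong coordinate per misplaced point embeds these points injectively
        into the pairs that are summed.\<close>
      define wit where "wit x = (SOME i. i < d \<and> B (i, x) \<noteq> true_rank ps i x)" for x
      have wit: "wit x < d \<and> B (wit x, x) \<noteq> true_rank ps (wit x) x" if "x \<in> ?bad" for x
        unfolding wit_def by (rule someI_ex) (use that in auto)
      have "ennreal 1 \<le> ennreal (real (card ?bad) * (1 / real (Suc c)))"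
        using many by (intro ennreal_leI) (simp add: field_simps)
      also have "\<dots> = (\<Sum>x\<in>?bad. ennreal (1 / real (Suc c)))"
        by (subst sum_ennreal) simp_all
      also have "\<dots> \<le> (\<Sum>x\<in>?bad. ?f (wit x, x))"
        by (rule sum_mono) (use wit in \<open>auto intro!: ennreal_leI\<close>)
      also have "\<dots> = (\<Sum>q\<in>(\<lambda>x. (wit x, x)) ` ?bad. ?f q)"
        by (subst sum.reindex) (auto simp: inj_on_def)
      also have "\<dots> \<le> (\<Sum>q\<in>?I. ?f q)"
        by (rule sum_mono2) (use wit in auto)
      finally show False using less by simp
    qed
    ultimately show "good_ranks ps S0 c B" by (auto simp: good_ranks_def)
  qed auto
  ultimately show ?thesis by simp
qed

lemma picks_subset: "set F \<subseteq> {..<n} \<Longrightarrow> set (picks k F) \<subseteq> {..<n}"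
proof (induction k arbitrary: F)
  case (Suc k)
  then show ?case using next_point_in_sky[of F] by (auto simp: sky_def)
qed simp

lemma fails_le_attempt:
  assumes n: "2 ^ (10 * l) \<le> n" and d: "d \<le> 2 ^ l" and l: "6 \<le> l"
  shows "fails_le (attempt n d l) Q (\<lambda>r. r = target (2 ^ l) []) (1 / 2 ^ l)"
proof -
  define fl where "fl = floor_log n"
  define h where "h = fl - 3 * l"
  \<comment> \<open>Chosen so that K^2 crowds of this size have \<open>2 ^ (h - 2)\<close> points in
    total, while \<open>m / n\<close> is still at least 1 / (8 K^5).\<close>
  define m :: nat where "m = 2 ^ (fl - 5 * l - 2)"
  \<comment> \<open>Half of the candidate budget \<open>2 ^ h\<close>; the 1 taken off makes room
    for the wanted point itself.\<close>
  define c :: nat where "c = 2 ^ (h - 1) - 1"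
  define S0 where "S0 = set (picks (2 ^ l) [])"
  let ?s = "2 ^ (10 * l) :: nat"
  define K where "K = (2::real) ^ l"
  have "0 < n" using n by (cases n) auto
  have fl: "10 * l \<le> fl" using floor_log_attempt[OF _ n] l by (simp add: fl_def)
  have n_less: "n < 2 * 2 ^ fl" unfolding fl_def using floor_log_exp2_gt[of n] by simp
  have S0: "finite S0" "S0 \<subseteq> {..<n}" "card S0 \<le> 2 ^ l"
    using picks_subset[of "[]" "2 ^ l"] length_picks[of "2 ^ l" "[]"] card_length[of "picks (2 ^ l) []"]
    by (auto simp: S0_def)
  have Suc_c: "Suc c = 2 ^ (h - 1)" by (simp add: c_def)
  have h_eq: "h = Suc (h - 1)" "h - 1 = Suc (h - 2)" "h - 2 = 2 * l + (fl - 5 * l - 2)"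
    using fl l by (auto simp: h_def)
  have enough: "c + card S0 * d * m + 1 \<le> 2 ^ h"
  proof -
    have "card S0 * d * m \<le> 2 ^ l * 2 ^ l * m" using S0 d by (intro mult_mono) auto
    also have "\<dots> = 2 ^ (h - 2)" unfolding m_def h_eq(3) by (simp add: power_add mult_2)
    also have "\<dots> \<le> 2 ^ (h - 1)" by (rule power_increasing) auto
    finally have "card S0 * d * m \<le> 2 ^ (h - 1)" .
    moreover have "(2::nat) ^ h = 2 * 2 ^ (h - 1)" by (subst h_eq(1)) simp
    ultimately show ?thesis using Suc_c by linarith
  qed
  have "(2::real) ^ 6 \<le> K" unfolding K_def using l by (intro power_increasing) auto
  then have K: "64 \<le> K" by simp
  have K_pow: "(2::real) ^ (k * l) = K ^ k" for k by (simp add: K_def power_mult[symmetric] mult.commute)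
  have dK: "real d \<le> K" using of_nat_mono[OF d, where 'a = real] by (simp add: K_def)
  have S0K: "real (card S0) \<le> K" using of_nat_mono[OF S0(3), where 'a = real] by (simp add: K_def)
  let ?p = "real m / real n"
  have p: "1 / (8 * K ^ 5) \<le> ?p"
  proof -
    have "(2::real) ^ fl = 2 ^ (5 * l + 2 + (fl - 5 * l - 2))"
      by (rule arg_cong[where f = "\<lambda>k. 2 ^ k"]) (use fl l in simp)
    also have "\<dots> = 2 ^ (5 * l) * 4 * real m" unfolding m_def power_add by simp
    finally have "(2::real) ^ fl = 2 ^ (5 * l) * 4 * real m" .
    moreover have "real n \<le> 2 * 2 ^ fl"
      using of_nat_mono[OF less_imp_le[OF n_less], where 'a = real] by simp
    ultimately have "real n \<le> 8 * K ^ 5 * real m"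
      by (simp add: K_pow)
    then show ?thesis using \<open>0 < n\<close> K by (simp add: field_simps)
  qed
  \<comment> \<open>Failure has three sources: the pivots leave too large a crowd, points are
    misplaced, or a round goes wrong.\<close>
  let ?ed = "max 0 (1 - ?p) ^ ?s"
  let ?ep = "(real ?s + (real (card S0) + real n / real (Suc c))) * real d * (real (2 * ?s) / 2 ^ (30 * l))"
  let ?el = "real (2 ^ l) * (2 * (real (d * (2 ^ l + 1) ^ 2) / 2 ^ (30 * l)))"
  have ed: "real (card S0 * d) * ?ed \<le> 8 / K ^ 3"
  proof -
    have "K ^ 5 / 8 = K ^ 10 * (1 / (8 * K ^ 5))" using K by (simp add: field_simps flip: power_add)
    also have "\<dots> \<le> K ^ 10 * ?p" using p by (intro mult_left_mono) auto
    also have "K ^ 10 = real ?s" by (simp add: K_pow)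
    finally have "?ed * (K ^ 5 / 8) \<le> ?ed * (real ?s * ?p)" by (intro mult_left_mono) auto
    also have "\<dots> \<le> 1" by (rule miss_prob_le) simp
    finally have "?ed * (K ^ 5 / 8) \<le> 1" .
    then have "?ed \<le> 8 / K ^ 5" using K by (simp add: field_simps)
    moreover have "real (card S0 * d) \<le> K * K"
      unfolding of_nat_mult using S0K dK by (intro mult_mono) auto
    ultimately have "real (card S0 * d) * ?ed \<le> (K * K) * (8 / K ^ 5)"
      by (intro mult_mono) auto
    also have "\<dots> = 8 / K ^ 3" using K by (simp add: field_simps flip: power_add) (simp add: eval_nat_numeral)
    finally show ?thesis .
  qed
  have ep: "?ep \<le> 4 / K ^ 9"
  proof -
    have "(2::real) ^ fl = 2 ^ (3 * l + 1 + (h - 1))"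
      by (rule arg_cong[where f = "\<lambda>k. 2 ^ k"]) (use fl l in \<open>simp add: h_def\<close>)
    also have "\<dots> = 2 ^ (3 * l) * 2 * 2 ^ (h - 1)" unfolding power_add by simp
    finally have "(2::real) ^ fl = 2 ^ (3 * l) * 2 * 2 ^ (h - 1)" .
    moreover have "real n \<le> 2 * 2 ^ fl"
      using of_nat_mono[OF less_imp_le[OF n_less], where 'a = real] by simp
    ultimately have "real n \<le> 4 * K ^ 3 * real (Suc c)"
      unfolding Suc_c by (simp add: K_pow)
    then have "real n / real (Suc c) \<le> 4 * K ^ 3" by (simp add: field_simps del: of_nat_Suc)
    then have "real (card S0) + real n / real (Suc c) \<le> K + 4 * K ^ 3" using S0K by simp
    also have "\<dots> \<le> K ^ 10"
    proof -
      have "K * 1 \<le> K * K ^ 2" using K by (intro mult_left_mono) auto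
      then have "K \<le> K ^ 3" by (simp add: power3_eq_cube power2_eq_square)
      moreover have "5 * K ^ 3 \<le> K * K ^ 3" using K by (intro mult_right_mono) auto
      moreover have "K * K ^ 3 = K ^ 4" by (simp flip: power_Suc)
      moreover have "K ^ 4 \<le> K ^ 10" using K by (intro power_increasing) auto
      ultimately show ?thesis by linarith
    qed
    finally have "real (card S0) + real n / real (Suc c) \<le> K ^ 10" .
    moreover have s: "real ?s = K ^ 10" by (simp add: K_pow)
    ultimately have "(real ?s + (real (card S0) + real n / real (Suc c))) * real d \<le> (K ^ 10 + K ^ 10) * K"
      using dK K by (intro mult_mono add_mono) auto
    then have "?ep \<le> (K ^ 10 + K ^ 10) * K * (2 * K ^ 10 / K ^ 30)"
      using K s by (simp only: K_pow of_nat_mult of_nat_numeral) (intro mult_right_mono, auto)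
    also have "\<dots> = 4 / K ^ 9" using K by (simp add: field_simps flip: power_add) (simp add: eval_nat_numeral)
    finally show ?thesis .
  qed
  have el: "?el \<le> 8 / K ^ 26"
  proof -
    have "(K + 1) ^ 2 \<le> (2 * K) ^ 2" using K by (intro power_mono) auto
    then have "real d * (K + 1) ^ 2 \<le> K * (4 * K ^ 2)"
      using dK K by (intro mult_mono) (auto simp: power_mult_distrib)
    then have "real (d * (2 ^ l + 1) ^ 2) \<le> K * (4 * K ^ 2)" by (simp add: K_def add.commute)
    then have "K * (2 * (real (d * (2 ^ l + 1) ^ 2) / K ^ 30)) \<le> K * (2 * (K * (4 * K ^ 2) / K ^ 30))"
      using K by (intro mult_left_mono divide_right_mono) auto
    also have "K * (2 * (real (d * (2 ^ l + 1) ^ 2) / K ^ 30)) = ?el"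
      by (simp only: K_pow[of 30]) (simp add: K_def)
    also have "K * (2 * (K * (4 * K ^ 2) / K ^ 30)) = 8 / K ^ 26"
      using K by (simp add: field_simps flip: power_add) (simp add: eval_nat_numeral)
    finally show ?thesis .
  qed
  have total: "real (card S0 * d) * ?ed + (?ep + ?el) \<le> 1 / K"
  proof -
    have "4 / K ^ 9 \<le> 4 / K ^ 3" "8 / K ^ 26 \<le> 8 / K ^ 3"
      using K by (auto intro!: divide_left_mono power_increasing)
    moreover have "8 / K ^ 3 + (4 / K ^ 3 + 8 / K ^ 3) = 20 / K ^ 3"
      by (simp flip: add_divide_distrib)
    ultimately have "real (card S0 * d) * ?ed + (?ep + ?el) \<le> 20 / K ^ 3"
      using ed ep el by linarith
    also have "\<dots> \<le> 1 / K"
      using K by (intro const_over_power_le) auto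
    finally show ?thesis .
  qed
  show ?thesis
    unfolding attempt_def fl_def[symmetric] h_def[symmetric]
  proof (rule fails_le_bind[OF _ _ _ total[unfolded K_def]])
    have "fails_le (draw n ?s) Q (\<lambda>ps. \<forall>q\<in>S0 \<times> {..<d}. card (crowd ps (snd q) (fst q)) \<le> m)
        (real (card (S0 \<times> {..<d})) * ?ed)"
      by (rule fails_le_Ball) (use S0 fails_le_crowd[OF \<open>0 < n\<close>] in auto)
    then show "fails_le (draw n ?s) Q (\<lambda>ps. \<forall>q\<in>S0 \<times> {..<d}. card (crowd ps (snd q) (fst q)) \<le> m)
        (real (card S0 * d) * ?ed)" by (simp add: card_cartesian_product)
    show "0 \<le> ?ep + ?el" by (intro add_nonneg_nonneg mult_nonneg_nonneg divide_nonneg_nonneg) auto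
    fix ps assume ps: "ps \<in> outputs (draw n ?s)"
      and crowd: "\<forall>q\<in>S0 \<times> {..<d}. card (crowd ps (snd q) (fst q)) \<le> m"
    have ps: "set ps \<subseteq> {..<n}" "length ps \<le> ?s"
      using ps bounded_alg_outputs[OF bounded_alg_draw[OF \<open>0 < n\<close>]] by fastforce+
    show "fails_le (bind_alg (prepare n d (30 * l) ps)
        (\<lambda>B. sky_loop n d (30 * l) h B (2 ^ l) [])) Q (\<lambda>r. r = target (2 ^ l) []) (?ep + ?el)"
    proof (rule fails_le_bind[OF fails_le_good_ranks[OF ps S0(2)] _ _ order_refl])
      show "0 \<le> ?el" by (intro mult_nonneg_nonneg divide_nonneg_nonneg) auto
      fix B assume "good_ranks ps S0 c B"
      then show "fails_le (sky_loop n d (30 * l) h B (2 ^ l) []) Q (\<lambda>r. r = target (2 ^ l) []) ?el"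
        using fails_le_sky_loop[OF _ S0(1,2) _ enough, of ps B "2 ^ l" "[]" "2 ^ l + 1" "30 * l"] crowd
        by (auto simp: S0_def)
    qed
  qed
qed

lemma target_eq_sky:
  assumes "card sky < k"
  shows "target k [] = Some sky"
  by (rule target_complete) (use assms in auto)

text \<open>The bound reproduces itself: 1 / K for the present attempt and 2 / K^2 for the later
  stages make at most 2 / K, as K >= 2.\<close>

lemma fails_le_stages:
  assumes "d \<le> 2 ^ l" "6 \<le> l"
  shows "fails_le (stages n d l) Q (\<lambda>S. S = sky) (2 / 2 ^ l)"
  using assms
proof (induction "n - l" arbitrary: l rule: less_induct)
  case less
  show ?case
  proof (cases "n < 2 ^ (10 * l)")
    case True
    then have "stages n d l = sort_all n d l" by (simp add: stages.simps)
    moreover have "fails_le (sort_all n d l) Q (\<lambda>S. S = sky) (2 / 2 ^ l)"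
      by (rule fails_le_mono[OF fails_le_sort_all]) (use True less.prems in \<open>auto simp: divide_right_mono\<close>)
    ultimately show ?thesis by simp
  next
    case False
    have "l < 2 ^ l" by (rule less_exp)
    moreover have "(2::nat) ^ l \<le> 2 ^ (10 * l)" by (rule power_increasing) auto
    ultimately have "l < n" using False by linarith
    have d: "d \<le> 2 ^ (2 * l)"
      by (rule order_trans[OF less.prems(1)]) simp
    have IH: "fails_le (stages n d (2 * l)) Q (\<lambda>S. S = sky) (2 / 2 ^ (2 * l))"
      by (rule less.hyps) (use \<open>l < n\<close> d less.prems in auto)
    have eq: "stages n d l = bind_alg (attempt n d l)
       (\<lambda>r. case r of Some S \<Rightarrow> Return S | None \<Rightarrow> stages n d (2 * l))"
      using False less.prems by (simp add: stages.simps[of n d l])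
    show ?thesis unfolding eq
    proof (rule fails_le_bind[OF fails_le_attempt])
      show "fails_le (case r of Some S \<Rightarrow> Return S | None \<Rightarrow> stages n d (2 * l)) Q (\<lambda>S. S = sky)
          (2 / 2 ^ (2 * l))" if r: "r = target (2 ^ l) []" for r
      proof (cases r)
        case None
        then show ?thesis using IH by simp
      next
        case (Some S)
        then have "S = sky" using target_sound[of "[]" "2 ^ l" S] r by simp
        then show ?thesis using Some by (simp add: fails_le_Return)
      qed
      have "(2::real) ^ 1 \<le> 2 ^ l" using less.prems by (intro power_increasing) auto
      then have "(2::real) / (2 ^ l) ^ 2 \<le> 1 / 2 ^ l" by (intro const_over_power_le) auto
      then have "(2::real) / 2 ^ (2 * l) \<le> 1 / 2 ^ l" by (simp only: power_mult[symmetric] mult.commute)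
      then show "1 / 2 ^ l + 2 / 2 ^ (2 * l) \<le> (2::real) / 2 ^ l" by simp
    qed (use False less.prems in auto)
  qed
qed

section \<open>Expected number of queries\<close>

lemma ewp_stages_step:
  fixes e E :: real
  assumes n: "2 ^ (10 * l) \<le> n" and l: "0 < l" and E: "0 \<le> E"
    and none: "fails_le (attempt n d l) Q (\<lambda>r. r \<noteq> None) e"
    and rest: "\<And>t. ewp (stages n d (2 * l)) Q t (\<lambda>_ t'. of_nat t') \<le> of_nat t + ennreal E"
  shows "ewp (stages n d l) Q t (\<lambda>_ t'. of_nat t') \<le> of_nat t + ennreal (16000 * real n * real d * real l + e * E)"
proof -
  have e: "0 \<le> e" using none by (auto simp: fails_le_def)
  let ?f = "\<lambda>r (_::nat). if r \<noteq> None then 0 else (1::ennreal)"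
  have "stages n d l = bind_alg (attempt n d l)
       (\<lambda>r. case r of Some S \<Rightarrow> Return S | None \<Rightarrow> stages n d (2 * l))"
    using assms by (simp add: stages.simps[of n d l])
  then have "ewp (stages n d l) Q t (\<lambda>_ t'. of_nat t') = ewp (attempt n d l) Q t
      (\<lambda>r t'. ewp (case r of Some S \<Rightarrow> Return S | None \<Rightarrow> stages n d (2 * l)) Q t' (\<lambda>_ t'. of_nat t'))"
    by (simp only: ewp_bind)
  also have "\<dots> \<le> ewp (attempt n d l) Q t
      (\<lambda>r t'. (of_nat t + ennreal (16000 * real n * real d * real l)) + ennreal E * ?f r t')"
  \<comment> \<open>The cost of an attempt is bounded on every branch, so the counter is replaced by
    a constant before averaging. Only the probability of \<open>None\<close> remains, whatever its
    correlation with the count.\<close>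
  proof (rule ewp_mono_bounded[OF bounded_alg_attempt[OF l n]])
    fix r :: "nat set option" and t'
    assume "t' \<le> t + 16000 * n * d * l"
    then have "(of_nat t' :: ennreal) \<le> of_nat (t + 16000 * n * d * l)" by (simp only: of_nat_le_iff)
    also have "\<dots> = of_nat t + ennreal (16000 * real n * real d * real l)"
      by (rule of_nat_add_cost)
    finally have t': "of_nat t' \<le> of_nat t + ennreal (16000 * real n * real d * real l)" .
    show "ewp (case r of Some S \<Rightarrow> Return S | None \<Rightarrow> stages n d (2 * l)) Q t' (\<lambda>_ t'. of_nat t')
        \<le> (of_nat t + ennreal (16000 * real n * real d * real l)) + ennreal E * ?f r t'"
    proof (cases r)
      case None
      have "ewp (stages n d (2 * l)) Q t' (\<lambda>_ t'. of_nat t') \<le> of_nat t' + ennreal E" by (rule rest)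
      also have "\<dots> \<le> of_nat t + ennreal (16000 * real n * real d * real l) + ennreal E" by (intro add_right_mono t')
      finally show ?thesis using None by simp
    qed (use t' in simp)
  qed
  also have "\<dots> = of_nat t + ennreal (16000 * real n * real d * real l) + ennreal E * ewp (attempt n d l) Q t ?f"
    by (simp only: ewp_add ewp_const ewp_cmult)
  also have "\<dots> \<le> of_nat t + ennreal (16000 * real n * real d * real l) + ennreal E * ennreal e"
    using none by (intro add_left_mono mult_left_mono) (auto simp: fails_le_def)
  also have "\<dots> = of_nat t + ennreal (16000 * real n * real d * real l + e * E)"
    using E e by (simp add: ennreal_mult[symmetric] add.assoc mult.commute flip: ennreal_plus)
  finally show ?thesis .
qed

text \<open>The bound is a potential. If the skyline is smaller than 2^l, an attempt costs l and is
  followed by another stage with probability at most 1/4, and l + 4 l / 4 = 2 l. Otherwise the next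
  stage is charged in full; the factor 6 pays for the step into the first case, where l + 4 l = 6 l
  - l and l is at most log 2 of the size of the skyline.\<close>

lemma ewp_stages_le:
  fixes c :: real
  assumes "d \<le> 2 ^ l" "6 \<le> l"
  defines "c \<equiv> 16000 * real n * real d"
  shows "ewp (stages n d l) Q t (\<lambda>_ t'. of_nat t') \<le>
    of_nat t + ennreal (c * (if card sky < 2 ^ l then 2 * real l else 6 * log 2 (card sky) - real l))"
  using assms(1,2)
proof (induction "n - l" arbitrary: l t rule: less_induct)
  case less
  have c: "0 \<le> c" by (simp add: c_def)
  define bnd where "bnd l = (if card sky < 2 ^ l then 2 * real l else 6 * log 2 (card sky) - real l)" for l
  have log: "real l \<le> log 2 (card sky)" if "\<not> card sky < 2 ^ l" for l
  proof -
    have "(2::real) ^ l \<le> real (card sky)" using that of_nat_mono[of "2 ^ l" "card sky", where 'a = real] by simp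
    then have "log 2 (2 ^ l) \<le> log 2 (card sky)" by (intro log_mono) auto
    then show ?thesis by simp
  qed
  have bnd: "real l \<le> bnd l" for l
    using log[of l] by (auto simp: bnd_def)
  show ?case unfolding bnd_def[symmetric]
  proof (cases "n < 2 ^ (10 * l)")
    case True
    then have "stages n d l = sort_all n d l" by (simp add: stages.simps)
    then have "ewp (stages n d l) Q t (\<lambda>_ t'. of_nat t') \<le> ewp (stages n d l) Q t (\<lambda>_ _. of_nat (t + 16000 * n * d * l))"
      by (simp only:) (rule ewp_mono_bounded[OF bounded_alg_sort_all], simp only: of_nat_le_iff)
    also have "\<dots> = of_nat t + ennreal (c * real l)"
      unfolding ewp_const c_def by (rule of_nat_add_cost)
    also have "\<dots> \<le> of_nat t + ennreal (c * bnd l)"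
      using bnd[of l] c by (intro add_left_mono ennreal_leI mult_left_mono)
    finally show "ewp (stages n d l) Q t (\<lambda>_ t'. of_nat t') \<le> of_nat t + ennreal (c * bnd l)" .
  next
    case False
    have "l < 2 ^ l" by (rule less_exp)
    moreover have "(2::nat) ^ l \<le> 2 ^ (10 * l)" by (rule power_increasing) auto
    ultimately have "l < n" using False by linarith
    have d: "d \<le> 2 ^ (2 * l)"
      by (rule order_trans[OF less.prems(1)]) simp
    have IH: "ewp (stages n d (2 * l)) Q t (\<lambda>_ t'. of_nat t') \<le> of_nat t + ennreal (c * bnd (2 * l))" for t
      unfolding bnd_def by (rule less.hyps) (use \<open>l < n\<close> d less.prems in auto)
    have n: "2 ^ (10 * l) \<le> n" "0 < l" using False less.prems by auto
    have nonneg: "0 \<le> c * bnd (2 * l)" using c bnd[of "2 * l"] by (intro mult_nonneg_nonneg) auto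
    show "ewp (stages n d l) Q t (\<lambda>_ t'. of_nat t') \<le> of_nat t + ennreal (c * bnd l)"
    proof (cases "card sky < 2 ^ l")
      case True
      have "card sky < 2 ^ (2 * l)"
        by (rule order.strict_trans2[OF True]) simp
      then have b2: "bnd (2 * l) = 4 * real l" by (simp add: bnd_def)
      have b1: "bnd l = 2 * real l" using True by (simp add: bnd_def)
      have "(2::real) ^ 2 \<le> 2 ^ l" using less.prems by (intro power_increasing) auto
      then have "(1::real) / 2 ^ l \<le> 1 / 4" by (simp add: field_simps)
      then have none: "fails_le (attempt n d l) Q (\<lambda>r. r \<noteq> None) (1 / 4)"
        by (intro fails_le_mono[OF fails_le_attempt]) (use target_eq_sky[OF True] n less.prems in auto)
      have "16000 * real n * real d * real l + 1 / 4 * (c * bnd (2 * l)) = c * bnd l"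
        unfolding b1 b2 c_def by simp
      then show ?thesis using ewp_stages_step[OF n nonneg none IH, of t] by simp
    next
      case False
      have none: "fails_le (attempt n d l) Q (\<lambda>r. r \<noteq> None) 1"
        unfolding fails_le_def
      proof (intro conjI allI)
        fix t
        have "ewp (attempt n d l) Q t (\<lambda>r _. if r \<noteq> None then 0 else 1) \<le> ewp (attempt n d l) Q t (\<lambda>_ _. 1)"
          by (rule ewp_mono) auto
        then show "ewp (attempt n d l) Q t (\<lambda>r _. if r \<noteq> None then 0 else 1) \<le> ennreal 1"
          by (simp add: ewp_const)
      qed simp
      have "real l + bnd (2 * l) \<le> bnd l"
        using False log[OF False] by (auto simp: bnd_def)
      then have "c * (real l + bnd (2 * l)) \<le> c * bnd l" using c by (intro mult_left_mono)
      then have "16000 * real n * real d * real l + 1 * (c * bnd (2 * l)) \<le> c * bnd l"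
        by (simp add: c_def distrib_left)
      then show ?thesis using ewp_stages_step[OF n nonneg none IH, of t]
        by (meson add_left_mono ennreal_leI order_trans)
    qed
  qed
qed

lemma sky_nonempty: "0 < n \<Longrightarrow> sky \<noteq> {}"
  using next_point_in_sky[of "[]"] by (auto simp: uncovered_def covered_def)

lemma expected_queries_stages:
  assumes \<delta>: "0 < \<delta>" "\<delta> < 1 / 2" and "0 < n" "0 < d"
  defines "l \<equiv> nat \<lceil>log 2 (real d / \<delta>)\<rceil> + 6"
  shows "expected_queries (stages n d l) Q
     \<le> ennreal (384000 * real n * real d * ln (real d * real (card sky) / \<delta>))"
    and "d \<le> 2 ^ l" and "2 / 2 ^ l \<le> \<delta>"
proof -
  define L where "L = ln (real d * real (card sky) / \<delta>)"
  have dd: "1 \<le> real d / \<delta>" and pos: "0 < real d / \<delta>"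
    using assms by (auto simp: field_simps)
  have l_ge: "log 2 (real d / \<delta>) + 6 \<le> real l" unfolding l_def by linarith
  have "0 \<le> log 2 (real d / \<delta>)" using dd by simp
  then have l_le: "real l \<le> log 2 (real d / \<delta>) + 7" unfolding l_def by linarith
  have "2 powr (log 2 (real d / \<delta>) + 6) \<le> 2 powr (real l)" by (rule powr_mono[OF l_ge]) simp
  \<comment> \<open>The summand 6 in \<open>l\<close> gives the factor 64. It leaves room for
    \<open>d \<le> 2 ^ l\<close> and \<open>2 / 2 ^ l \<le> \<delta>\<close>, and it ensures
    \<open>6 \<le> l\<close>.\<close>
  then have big: "64 * (real d / \<delta>) \<le> 2 ^ l"
    using pos by (simp add: powr_add powr_realpow mult.commute)
  have "real d \<le> real d / \<delta>" using \<delta> mult_right_mono[of \<delta> 1 "real d"] by (simp add: field_simps)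
  then have "real d \<le> 2 ^ l" using big pos by linarith
  then show d: "d \<le> 2 ^ l" using of_nat_le_iff[of d "2 ^ l", where 'a = real] by simp
  have "1 \<le> real d" using \<open>0 < d\<close> by simp
  then have "2 \<le> \<delta> * (64 * (real d / \<delta>))" using \<delta> by simp
  also have "\<dots> \<le> \<delta> * 2 ^ l" using big \<delta> by (intro mult_left_mono) auto
  finally show "2 / 2 ^ l \<le> \<delta>" by (simp add: field_simps)
  have "finite sky" by (simp add: sky_def)
  then have k: "1 \<le> real (card sky)"
    using sky_nonempty \<open>0 < n\<close> by (simp add: Suc_le_eq card_gt_0_iff)
  have k_pos: "0 < real (card sky)" using k by linarith
  have L: "L = ln (real d / \<delta>) + ln (real (card sky))"
    unfolding L_def using pos k_pos by (subst ln_mult_pos[symmetric]) (auto simp: mult.commute)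
  have nonneg: "0 \<le> ln (real d / \<delta>)" "0 \<le> ln (real (card sky))" using dd k by auto
  have ln2: "2 / 3 \<le> ln (2::real)" using ln2_ge_two_thirds .
  have log_le: "log 2 x \<le> 3 / 2 * ln x" if "0 \<le> ln x" for x
  proof -
    have "ln x * 1 \<le> ln x * (3 / 2 * ln 2)" using that ln2 by (intro mult_left_mono) auto
    then show ?thesis by (simp add: log_def field_simps)
  qed
  have "2 \<le> real d / \<delta>"
  proof -
    have "2 * \<delta> \<le> real d" using \<delta> \<open>1 \<le> real d\<close> by linarith
    then show ?thesis using \<delta> by (simp add: field_simps)
  qed
  then have "ln 2 \<le> ln (real d / \<delta>)" using pos by simp
  then have L_ge: "2 / 3 \<le> L" using ln2 L nonneg by linarith
  have "log 2 (real d / \<delta>) \<le> 3 / 2 * L" using log_le[OF nonneg(1)] L nonneg by simp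
  \<comment> \<open>The additive 7 is absorbed through 7 <= 21/2 L and 3/2 + 21/2 = 12. Doubling
    gives 24, and 16000 * 24 = 384000.\<close>
  then have "real l \<le> 12 * L" using l_le L_ge by linarith
  moreover have "log 2 (real (card sky)) \<le> 3 / 2 * L" using log_le[OF nonneg(2)] L nonneg by simp
  ultimately have "(if card sky < 2 ^ l then 2 * real l else 6 * log 2 (card sky) - real l) \<le> 24 * L"
    using L_ge by auto
  then have "16000 * real n * real d * (if card sky < 2 ^ l then 2 * real l else 6 * log 2 (card sky) - real l)
      \<le> 16000 * real n * real d * (24 * L)"
    by (intro mult_left_mono) auto
  then have cost: "16000 * real n * real d * (if card sky < 2 ^ l then 2 * real l else 6 * log 2 (card sky) - real l)
      \<le> 384000 * real n * real d * L" by simp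
  have "expected_queries (stages n d l) Q = ewp (stages n d l) Q 0 (\<lambda>_ t'. of_nat t')"
    by (simp add: expected_queries_def ewp_eq_nn_integral)
  also have "\<dots> \<le> of_nat 0 + ennreal (16000 * real n * real d *
      (if card sky < 2 ^ l then 2 * real l else 6 * log 2 (card sky) - real l))"
    by (rule ewp_stages_le[OF d]) (simp add: l_def)
  also have "\<dots> = ennreal (16000 * real n * real d *
      (if card sky < 2 ^ l then 2 * real l else 6 * log 2 (card sky) - real l))" by simp
  also have "\<dots> \<le> ennreal (384000 * real n * real d * L)" by (rule ennreal_leI[OF cost])
  finally show "expected_queries (stages n d l) Q
     \<le> ennreal (384000 * real n * real d * ln (real d * real (card sky) / \<delta>))"
    unfolding L_def .
qed

end

section \<open>From failure bounds on labels to the statement about points\<close>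

lemma success_prob_fails_le:
  assumes "fails_le A Q P e"
  shows "1 - e \<le> success_prob A Q P"
proof -
  let ?M = "measure_pmf (run A Q 0)"
  have "emeasure ?M {(r, t). \<not> P r} = (\<integral>\<^sup>+ x. indicator {(r, t). \<not> P r} x \<partial>?M)" by simp
  also have "\<dots> = ewp A Q 0 (\<lambda>r _. if P r then 0 else 1)"
    unfolding ewp_eq_nn_integral by (rule nn_integral_cong) (auto split: split_indicator)
  also have "\<dots> \<le> ennreal e" using assms by (simp add: fails_le_def)
  finally have "measure_pmf.prob (run A Q 0) {(r, t). \<not> P r} \<le> e"
    using fails_le_nonneg[OF assms] by (simp add: measure_pmf.emeasure_eq_measure)
  moreover have compl: "{(r, t). \<not> P r} = UNIV - {(r, t). P r}" by auto
  have "measure_pmf.prob (run A Q 0) {(r, t). \<not> P r} = 1 - success_prob A Q P"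
    unfolding success_prob_def compl
    using measure_pmf.prob_compl[of "{(r, t). P r}" "run A Q 0"] by simp
  ultimately show ?thesis by linarith
qed

text \<open>For \<open>n = 0\<close> or \<open>d = 0\<close> the claimed bound is zero, so no query
  may be made. Returning all labels is right, since without coordinates nothing is strictly
  dominated.\<close>

definition skyline_alg :: "real \<Rightarrow> nat \<Rightarrow> nat \<Rightarrow> (cmp_query, nat set) query_alg" where
  "skyline_alg \<delta> n d = (if n = 0 \<or> d = 0 then Return {..<n}
     else stages n d (nat \<lceil>log 2 (real d / \<delta>)\<rceil> + 6))"

lemma skyline_alg_correct:
  assumes \<delta>: "0 < \<delta>" "\<delta> < 1 / 2" and X: "X \<subseteq> space_of_dim d" and pt: "bij_betw pt {..<n} X"
    and Q: "noisy_oracle n d pt Q"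
  shows "1 - \<delta> \<le> success_prob (skyline_alg \<delta> n d) Q (\<lambda>S. pt ` S = skyline d X) \<and>
    expected_queries (skyline_alg \<delta> n d) Q
      \<le> ennreal (384000 * real n * real d * ln (real d * real (card (skyline d X)) / \<delta>))"
proof (cases "n = 0 \<or> d = 0")
  case True
  then have alg: "skyline_alg \<delta> n d = Return {..<n}" by (simp add: skyline_alg_def)
  have "pt ` {..<n} = X" using pt by (simp add: bij_betw_def)
  moreover have "skyline d X = X"
    using True \<open>pt ` {..<n} = X\<close> by (auto simp: skyline_def strictly_dominated_def)
  ultimately show ?thesis
    using \<delta> by (simp add: alg success_prob_def expected_queries_def nn_integral_return_pmf)
next
  case False
  have inj: "inj_on pt {..<n}" and im: "pt ` {..<n} = X" using pt by (auto simp: bij_betw_def)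
  interpret noisy_points n d pt Q
  proof
    show "noisy_oracle n d pt Q" by (rule Q)
    fix x y assume xy: "x < n" "y < n" "\<And>i. i < d \<Longrightarrow> pt x i = pt y i"
    have "pt x \<in> space_of_dim d" "pt y \<in> space_of_dim d" using X im xy by auto
    then have "pt x = pt y" by (rule PiE_ext) (use xy in auto)
    then show "x = y" using inj xy by (auto dest: inj_onD)
  qed
  have strict: "strictly_dominated d (pt x) (pt y) \<longleftrightarrow> (\<forall>i<d. pt x i \<le> pt y i)"
    if "x < n" "y < n" "y \<noteq> x" for x y
    using separated[of x y] that
    by (force simp: strictly_dominated_def dominated_def order.order_iff_strict)
  have sky_iff: "pt x \<in> skyline d X \<longleftrightarrow> x \<in> sky" if x: "x < n" for x
  proof -
    have "X - {pt x} = pt ` {y. y < n \<and> y \<noteq> x}"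
      using im inj x by (auto simp: inj_on_def)
    then have "pt x \<in> skyline d X \<longleftrightarrow> \<not> (\<exists>y<n. y \<noteq> x \<and> strictly_dominated d (pt x) (pt y))"
      using im x by (auto simp: skyline_def)
    then show ?thesis using strict[OF x] x by (auto simp: sky_def)
  qed
  have sky: "pt ` sky = skyline d X"
  proof
    show "pt ` sky \<subseteq> skyline d X" using sky_iff by (auto simp: sky_def)
    show "skyline d X \<subseteq> pt ` sky"
    proof
      fix p assume p: "p \<in> skyline d X"
      then obtain x where "x < n" "p = pt x" using im by (auto simp: skyline_def)
      then show "p \<in> pt ` sky" using p sky_iff by auto
    qed
  qed
  have "inj_on pt sky" by (rule inj_on_subset[OF inj]) (auto simp: sky_def)
  then have card: "card (skyline d X) = card sky" unfolding sky[symmetric] by (rule card_image)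
  let ?l = "nat \<lceil>log 2 (real d / \<delta>)\<rceil> + 6"
  have alg: "skyline_alg \<delta> n d = stages n d ?l" using False by (simp add: skyline_alg_def)
  have "0 < n" "0 < d" using False by auto
  note bounds = expected_queries_stages[OF \<delta> this]
  have "fails_le (stages n d ?l) Q (\<lambda>S. pt ` S = skyline d X) \<delta>"
    by (rule fails_le_mono[OF fails_le_stages[OF bounds(2)] _ bounds(3)]) (auto simp: sky)
  then show ?thesis using bounds(1) success_prob_fails_le unfolding alg card by blast
qed

theorem theorem1:
  "\<exists>(alg :: real \<Rightarrow> nat \<Rightarrow> nat \<Rightarrow> (cmp_query, nat set) query_alg) (C :: real). C > 0 \<and>
     (\<forall>(\<delta> :: real) (n :: nat) (d :: nat). 0 < \<delta> \<longrightarrow> \<delta> < 1 / 2 \<longrightarrow>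
        queries (alg \<delta> n d) \<subseteq> cmp_queries n d \<and>
        outputs (alg \<delta> n d) \<subseteq> Pow {..<n} \<and>
        (\<forall>(X :: point set) (pt :: nat \<Rightarrow> point) (Q :: nat \<Rightarrow> cmp_query \<Rightarrow> bool pmf).
           X \<subseteq> space_of_dim d \<longrightarrow> bij_betw pt {..<n} X \<longrightarrow> noisy_oracle n d pt Q \<longrightarrow>
             success_prob (alg \<delta> n d) Q (\<lambda>S. pt ` S = skyline d X) \<ge> 1 - \<delta> \<and>
             expected_queries (alg \<delta> n d) Q
               \<le> ennreal (C * real n * real d * ln (real d * real (card (skyline d X)) / \<delta>))))"
proof -
  have "queries (skyline_alg \<delta> n d) \<subseteq> cmp_queries n d \<and> outputs (skyline_alg \<delta> n d) \<subseteq> Pow {..<n}"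
    for \<delta> n d
  proof (cases "n = 0 \<or> d = 0")
    case False
    then have "skyline_alg \<delta> n d = stages n d (nat \<lceil>log 2 (real d / \<delta>)\<rceil> + 6)"
      by (simp add: skyline_alg_def)
    then obtain c where "bounded_alg (skyline_alg \<delta> n d) (cmp_queries n d) (Pow {..<n}) c"
      using bounded_alg_stages by metis
    then show ?thesis using bounded_alg_queries bounded_alg_outputs by blast
  qed (auto simp: skyline_alg_def)
  then show ?thesis
    using skyline_alg_correct
    by (intro exI[of _ skyline_alg] exI[of _ "384000 :: real"]) auto
qed

end
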